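(* The class of effective subshifts is closed under topological factor maps. That is, if $\Gamma$ is a finitely generated group, $X\subset A^\Gamma$ is an effective subshift, and $Y\subset B^\Gamma$ is a subshift which is a topological factor of $X$ (with $A,B$ finite alphabets), then $Y$ is effective.
   Context: For a finite alphabet $A$, $\Gamma$ acts on $A^\Gamma$ (prodiscrete topology) by $(gx)(h)=x(g^{-1}h)$; a $\Gamma$-subshift is a closed $\Gamma$-invariant subset with the shift action. $Y$ is a topological factor of $X$ if there is a continuous surjective $\Gamma$-equivariant map $X\to Y$. Let $S$ be a finite generating set of $\Gamma$, $F(S)$ the free group on $S$, $\phi\colon F(S)\to\Gamma$ the canonical epimorphism. The pullback of a subshift $X\subset A^\Gamma$ is $\widehat X=\{x\circ\phi:x\in X\}\subset A^{F(S)}$. $X$ is effective if for some (equivalently any) finite generating set $S$ the set $\widehat X$ is effectively closed in $A^{F(S)}$, i.e. the set of patterns $p\colon W\to A$, $W\subset F(S)$ finite, such that no $y\in\widehat X$ satisfies $y|_W=p$ is recursively enumerable. *)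

theory Defs
  imports
    "HOL-Algebra.Generated_Groups"
    "HOL-Analysis.Analysis"
    "HOL-Library.Countable_Set"
    "HOL-Library.Nat_Bijection"
begin

section \<open>Partial recursive functions and recursively enumerable sets\<close>

text \<open>
  Terms for the mu-recursive functions.  Terms carry no arity; a term is applied to an argument
  list, and a term applied to a list of the wrong shape has no value.
\<close>

datatype recf =
    Zero
  | Succ
  | Proj nat
  | Comp recf "recf list"
  | PrimRec recf recf
  | Mu recf

inductive rec_eval :: "recf \<Rightarrow> nat list \<Rightarrow> nat \<Rightarrow> bool" where
  zero: "rec_eval Zero xs 0"
| succ: "rec_eval Succ [x] (Suc x)"
| proj: "i < length xs \<Longrightarrow> rec_eval (Proj i) xs (xs ! i)"
| comp: "list_all2 (\<lambda>g y. rec_eval g xs y) gs ys \<Longrightarrow> rec_eval f ys z \<Longrightarrow>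
    rec_eval (Comp f gs) xs z"
| primrec_0: "rec_eval f xs y \<Longrightarrow> rec_eval (PrimRec f g) (0 # xs) y"
| primrec_Suc: "rec_eval (PrimRec f g) (n # xs) r \<Longrightarrow> rec_eval g (n # r # xs) y \<Longrightarrow>
    rec_eval (PrimRec f g) (Suc n # xs) y"
| mu: "rec_eval f (n # xs) 0 \<Longrightarrow> (\<And>m. m < n \<Longrightarrow> \<exists>k. rec_eval f (m # xs) (Suc k)) \<Longrightarrow>
    rec_eval (Mu f) xs n"

inductive_cases rec_eval_ZeroE: "rec_eval Zero xs y"
inductive_cases rec_eval_SuccE: "rec_eval Succ xs y"
inductive_cases rec_eval_ProjE: "rec_eval (Proj i) xs y"
inductive_cases rec_eval_CompE: "rec_eval (Comp f gs) xs y"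
inductive_cases rec_eval_PrimRec_0E: "rec_eval (PrimRec f g) (0 # xs) y"
inductive_cases rec_eval_PrimRec_SucE: "rec_eval (PrimRec f g) (Suc n # xs) y"
inductive_cases rec_eval_MuE: "rec_eval (Mu f) xs y"

lemma rec_eval_functional: "rec_eval f xs y \<Longrightarrow> rec_eval f xs z \<Longrightarrow> y = z"
proof (induction f xs y arbitrary: z rule: rec_eval.induct)
  case (zero xs)
  from zero.prems show ?case by (rule rec_eval_ZeroE) simp
next
  case (succ x)
  from succ.prems show ?case by (rule rec_eval_SuccE) simp
next
  case (proj i xs)
  from proj.prems show ?case by (rule rec_eval_ProjE) simp
next
  case (comp xs gs ys f u)
  from comp.prems obtain ys' where
    ys': "list_all2 (\<lambda>g y. rec_eval g xs y) gs ys'" "rec_eval f ys' z"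
    by (rule rec_eval_CompE)
  have "ys = ys'"
  proof (rule nth_equalityI)
    show len: "length ys = length ys'"
      by (rule trans[OF list_all2_lengthD[OF comp.IH(1), symmetric] list_all2_lengthD[OF ys'(1)]])
    fix i assume i: "i < length ys"
    have "rec_eval (gs ! i) xs (ys' ! i)"
      by (rule list_all2_nthD2[OF ys'(1)]) (use i len in linarith)
    moreover have "\<forall>z. rec_eval (gs ! i) xs z \<longrightarrow> ys ! i = z"
      using list_all2_nthD2[OF comp.IH(1) i] by (rule conjunct2)
    ultimately show "ys ! i = ys' ! i" by blast
  qed
  with ys'(2) have "rec_eval f ys z" by (simp only:)
  then show ?case by (rule comp.IH(2))
next
  case (primrec_0 f xs y g)
  from primrec_0.prems have "rec_eval f xs z" by (rule rec_eval_PrimRec_0E)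
  then show ?case by (rule primrec_0.IH)
next
  case (primrec_Suc f g n xs r y)
  from primrec_Suc.prems obtain r' where
    r': "rec_eval (PrimRec f g) (n # xs) r'" "rec_eval g (n # r' # xs) z"
    by (rule rec_eval_PrimRec_SucE)
  have "r = r'" using r'(1) by (rule primrec_Suc.IH(1))
  with r'(2) have "rec_eval g (n # r # xs) z" by (simp only:)
  then show ?case by (rule primrec_Suc.IH(2))
next
  case (mu f n xs)
  have z: "rec_eval f (z # xs) 0"
    using mu.prems by (rule rec_eval_MuE)
  have less_z: "\<exists>k. rec_eval f (m # xs) (Suc k)" if m: "m < z" for m
    by (rule rec_eval_MuE[OF mu.prems]) (use m in blast)
  show ?case
  proof (rule linorder_cases[of n z])
    assume "n < z"
    then obtain k where "rec_eval f (n # xs) (Suc k)" using less_z by blast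
    then have "0 = Suc k" by (rule mu.IH(1))
    then show ?thesis by (rule nat.distinct(1)[THEN notE])
  next
    assume "z < n"
    then obtain k where k: "\<forall>u. rec_eval f (z # xs) u \<longrightarrow> Suc k = u" using mu.IH(2) by blast
    from mp[OF spec[OF k] z] show ?thesis by (rule nat.distinct(2)[THEN notE])
  qed
qed

text \<open>A set of numbers is r.e. iff it is the domain of a unary partial recursive function.\<close>

definition recursively_enumerable :: "nat set \<Rightarrow> bool" where
  "recursively_enumerable U \<longleftrightarrow> (\<exists>f. U = {n. \<exists>y. rec_eval f [n] y})"


section \<open>The free group on a set\<close>

text \<open>
  Elements are reduced words in signed letters; \<open>(s, True)\<close> stands for \<open>s\<close> and \<open>(s, False)\<close> for
  its formal inverse.
\<close>

definition inv_letter :: "'s \<times> bool \<Rightarrow> 's \<times> bool" where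
  "inv_letter x = (fst x, \<not> snd x)"

definition reduced_word :: "('s \<times> bool) list \<Rightarrow> bool" where
  "reduced_word w \<longleftrightarrow> successively (\<lambda>x y. y \<noteq> inv_letter x) w"

fun push_letter :: "'s \<times> bool \<Rightarrow> ('s \<times> bool) list \<Rightarrow> ('s \<times> bool) list" where
  "push_letter x [] = [x]"
| "push_letter x (y # w) = (if y = inv_letter x then w else x # y # w)"

definition free_group :: "'s set \<Rightarrow> ('s \<times> bool) list monoid" where
  "free_group S =
    \<lparr>carrier = {w. set w \<subseteq> S \<times> UNIV \<and> reduced_word w}, monoid.mult = foldr push_letter, one = []\<rparr>"

definition word_value :: "('g, 'm) monoid_scheme \<Rightarrow> ('s \<Rightarrow> 'g) \<Rightarrow> ('s \<times> bool) list \<Rightarrow> 'g" where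
  "word_value G f w =
    foldr (\<lambda>x g. (if snd x then f (fst x) else inv\<^bsub>G\<^esub> f (fst x)) \<otimes>\<^bsub>G\<^esub> g) w \<one>\<^bsub>G\<^esub>"

definition canonical_epi :: "('g, 'm) monoid_scheme \<Rightarrow> ('g \<times> bool) list \<Rightarrow> 'g" where
  "canonical_epi G = word_value G (\<lambda>s. s)"

lemma inv_letter_inv_letter [simp]: "inv_letter (inv_letter x) = x"
  by (simp add: inv_letter_def)

lemma inv_letter_neq [simp]: "inv_letter x \<noteq> x"
  by (cases x) (simp add: inv_letter_def)

lemma reduced_word_Nil [simp]: "reduced_word []"
  by (simp add: reduced_word_def)

lemma reduced_word_ConsD: "reduced_word (x # w) \<Longrightarrow> reduced_word w"
  by (cases w) (auto simp: reduced_word_def)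

lemma reduced_word_push: "reduced_word w \<Longrightarrow> reduced_word (push_letter x w)"
  by (cases w) (auto simp: reduced_word_def successively_Cons)

lemma push_Cons: "reduced_word (x # w) \<Longrightarrow> push_letter x w = x # w"
  by (cases w) (auto simp: reduced_word_def)

lemma push_inv_push: "reduced_word w \<Longrightarrow> push_letter (inv_letter x) (push_letter x w) = w"
  by (cases w) (auto simp: push_Cons)

lemma push_push_inv: "reduced_word w \<Longrightarrow> push_letter x (push_letter (inv_letter x) w) = w"
  using push_inv_push[of w "inv_letter x"] by simp

lemma reduced_word_foldr: "reduced_word w \<Longrightarrow> reduced_word (foldr push_letter u w)"
  by (induction u) (auto intro: reduced_word_push)

lemma foldr_push_push:
  "reduced_word w \<Longrightarrow>
    foldr push_letter (push_letter x u) w = push_letter x (foldr push_letter u w)"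
  by (cases u) (auto simp: push_push_inv reduced_word_foldr)

lemma foldr_push_assoc:
  "reduced_word w \<Longrightarrow>
    foldr push_letter (foldr push_letter u v) w = foldr push_letter u (foldr push_letter v w)"
  by (induction u) (auto simp: foldr_push_push)

lemma foldr_push_Nil: "reduced_word w \<Longrightarrow> foldr push_letter w [] = w"
proof (induction w)
  case (Cons x w)
  then show ?case using reduced_word_ConsD[OF Cons.prems] by (simp add: push_Cons)
qed simp

lemma set_push: "set (push_letter x w) \<subseteq> insert x (set w)"
  by (cases w) auto

lemma set_foldr_push: "set (foldr push_letter u w) \<subseteq> set u \<union> set w"
proof (induction u)
  case (Cons x u)
  then show ?case using set_push[of x "foldr push_letter u w"] by auto
qed simp

lemma reduced_word_inverse: "reduced_word w \<Longrightarrow> reduced_word (rev (map inv_letter w))"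
  unfolding reduced_word_def successively_rev successively_map
  by (erule successively_mono) auto

lemma foldr_push_inverse: "foldr push_letter (rev (map inv_letter w)) w = []"
  by (induction w) auto

lemma group_free_group: "group (free_group S)"
proof (rule groupI)
  fix x y assume "x \<in> carrier (free_group S)" "y \<in> carrier (free_group S)"
  then show "x \<otimes>\<^bsub>free_group S\<^esub> y \<in> carrier (free_group S)"
    using set_foldr_push[of x y] by (auto simp: free_group_def reduced_word_foldr)
next
  fix x assume x: "x \<in> carrier (free_group S)"
  then have "rev (map inv_letter x) \<in> carrier (free_group S)"
    by (auto simp: free_group_def reduced_word_inverse inv_letter_def)
  moreover have "rev (map inv_letter x) \<otimes>\<^bsub>free_group S\<^esub> x = \<one>\<^bsub>free_group S\<^esub>"
    by (simp add: free_group_def foldr_push_inverse)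
  ultimately show
    "\<exists>y\<in>carrier (free_group S). y \<otimes>\<^bsub>free_group S\<^esub> x = \<one>\<^bsub>free_group S\<^esub>"
    by blast
qed (auto simp: free_group_def foldr_push_assoc)

context group
begin

lemma word_value_Nil [simp]: "word_value G f [] = \<one>"
  by (simp add: word_value_def)

lemma word_value_Cons [simp]:
  "word_value G f (x # w) = (if snd x then f (fst x) else inv f (fst x)) \<otimes> word_value G f w"
  by (simp add: word_value_def)

lemma word_value_closed:
  "f \<in> S \<rightarrow> carrier G \<Longrightarrow> set w \<subseteq> S \<times> UNIV \<Longrightarrow> word_value G f w \<in> carrier G"
proof (induction w)
  case (Cons x w)
  then have "f (fst x) \<in> carrier G" by auto
  with Cons show ?case by simp
qed simp

lemma word_value_push:
  assumes "f \<in> S \<rightarrow> carrier G" "fst x \<in> S" "set w \<subseteq> S \<times> UNIV"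
  shows "word_value G f (push_letter x w) = word_value G f (x # w)"
proof (cases w)
  case (Cons y v)
  have "f (fst x) \<in> carrier G" "word_value G f v \<in> carrier G"
    using assms Cons by (auto intro: word_value_closed)
  then show ?thesis
    using Cons by (auto simp: inv_letter_def m_assoc[symmetric])
qed simp

lemma word_value_foldr_push:
  assumes f: "f \<in> S \<rightarrow> carrier G" and "set u \<subseteq> S \<times> UNIV" "set w \<subseteq> S \<times> UNIV"
  shows "word_value G f (foldr push_letter u w) = word_value G f u \<otimes> word_value G f w"
  using assms(2)
proof (induction u)
  case Nil
  then show ?case using word_value_closed[OF f assms(3)] by simp
next
  case (Cons x u)
  have 1: "fst x \<in> S" "set (foldr push_letter u w) \<subseteq> S \<times> UNIV" "set u \<subseteq> S \<times> UNIV"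
    using Cons.prems assms(3) set_foldr_push[of u w] by auto
  have "f (fst x) \<in> carrier G" using f 1 by auto
  then show ?case
    using Cons.IH 1 word_value_closed[OF f] assms(3)
    by (simp add: word_value_push[OF f 1(1,2)] m_assoc)
qed

lemma word_value_hom:
  "f \<in> S \<rightarrow> carrier G \<Longrightarrow> word_value G f \<in> hom (free_group S) G"
  by (rule homI) (auto simp: free_group_def word_value_closed word_value_foldr_push)

lemma canonical_epi_hom: "S \<subseteq> carrier G \<Longrightarrow> canonical_epi G \<in> hom (free_group S) G"
  unfolding canonical_epi_def by (rule word_value_hom) auto

lemma canonical_epi_letter: "s \<in> carrier G \<Longrightarrow> canonical_epi G [(s, True)] = s"
  by (simp add: canonical_epi_def)

lemma canonical_epi_image:
  assumes S: "S \<subseteq> carrier G"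
  shows "canonical_epi G ` carrier (free_group S) = generate G S"
proof -
  interpret F: group "free_group S" by (rule group_free_group)
  interpret h: group_hom "free_group S" G "canonical_epi G"
    by unfold_locales (rule canonical_epi_hom[OF S])
  show ?thesis
  proof
    have "canonical_epi G w \<in> generate G S" if "set w \<subseteq> S \<times> UNIV" for w
      using that
    proof (induction w)
      case Nil
      show ?case by (simp add: canonical_epi_def generate.one)
    next
      case (Cons x w)
      then have "fst x \<in> S" by auto
      then have "fst x \<in> generate G S" "inv (fst x) \<in> generate G S"
        by (auto intro: generate.incl generate.inv)
      with Cons show ?case by (auto simp: canonical_epi_def intro: generate.eng)
    qed
    then show "canonical_epi G ` carrier (free_group S) \<subseteq> generate G S"
      by (auto simp: free_group_def)
  next
    have "S \<subseteq> canonical_epi G ` carrier (free_group S)"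
    proof
      fix s assume "s \<in> S"
      then have "[(s, True)] \<in> carrier (free_group S)" "canonical_epi G [(s, True)] = s"
        using S canonical_epi_letter by (auto simp: free_group_def reduced_word_def)
      then show "s \<in> canonical_epi G ` carrier (free_group S)" by (metis imageI)
    qed
    moreover have "subgroup (canonical_epi G ` carrier (free_group S)) G"
      by (rule h.img_is_subgroup)
    ultimately show "generate G S \<subseteq> canonical_epi G ` carrier (free_group S)"
      by (rule generate_subgroup_incl)
  qed
qed

end


section \<open>Subshifts and topological factors\<close>

definition full_shift_topology :: "('g, 'm) monoid_scheme \<Rightarrow> 'a set \<Rightarrow> ('g \<Rightarrow> 'a) topology" where
  "full_shift_topology G A = product_topology (\<lambda>_. discrete_topology A) (carrier G)"

definition shift :: "('g, 'm) monoid_scheme \<Rightarrow> 'g \<Rightarrow> ('g \<Rightarrow> 'a) \<Rightarrow> 'g \<Rightarrow> 'a" where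
  "shift G g x = (\<lambda>h\<in>carrier G. x (inv\<^bsub>G\<^esub> g \<otimes>\<^bsub>G\<^esub> h))"

definition subshift :: "('g, 'm) monoid_scheme \<Rightarrow> 'a set \<Rightarrow> ('g \<Rightarrow> 'a) set \<Rightarrow> bool" where
  "subshift G A X \<longleftrightarrow>
    closedin (full_shift_topology G A) X \<and> (\<forall>g\<in>carrier G. \<forall>x\<in>X. shift G g x \<in> X)"

definition topological_factor ::
    "('g, 'm) monoid_scheme \<Rightarrow> 'a set \<Rightarrow> ('g \<Rightarrow> 'a) set \<Rightarrow> 'b set \<Rightarrow> ('g \<Rightarrow> 'b) set \<Rightarrow> bool" where
  "topological_factor G A X B Y \<longleftrightarrow>
    (\<exists>f. continuous_map (subtopology (full_shift_topology G A) X)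
            (subtopology (full_shift_topology G B) Y) f \<and>
         f ` X = Y \<and>
         (\<forall>g\<in>carrier G. \<forall>x\<in>X. f (shift G g x) = shift G g (f x)))"

lemma topspace_full_shift: "topspace (full_shift_topology G A) = carrier G \<rightarrow>\<^sub>E A"
  by (simp add: full_shift_topology_def)


section \<open>Effective subshifts\<close>

definition finite_generating_set :: "('g, 'm) monoid_scheme \<Rightarrow> 'g set \<Rightarrow> bool" where
  "finite_generating_set G S \<longleftrightarrow> finite S \<and> S \<subseteq> carrier G \<and> generate G S = carrier G"

definition finitely_generated :: "('g, 'm) monoid_scheme \<Rightarrow> bool" where
  "finitely_generated G \<longleftrightarrow> (\<exists>S. finite_generating_set G S)"

definition pullback ::
    "('g, 'm) monoid_scheme \<Rightarrow> 'g set \<Rightarrow> ('g \<Rightarrow> 'a) set \<Rightarrow> (('g \<times> bool) list \<Rightarrow> 'a) set" where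
  "pullback G S X = (\<lambda>x. compose (carrier (free_group S)) x (canonical_epi G)) ` X"

text \<open>A pattern is a partial map on the free group; its support is the domain of the map.\<close>

definition patterns :: "'s set \<Rightarrow> 'a set \<Rightarrow> (('s \<times> bool) list \<rightharpoonup> 'a) set" where
  "patterns S A = {p. finite (dom p) \<and> dom p \<subseteq> carrier (free_group S) \<and> ran p \<subseteq> A}"

definition forbidden_patterns ::
    "'s set \<Rightarrow> 'a set \<Rightarrow> (('s \<times> bool) list \<Rightarrow> 'a) set \<Rightarrow> (('s \<times> bool) list \<rightharpoonup> 'a) set" where
  "forbidden_patterns S A Z =
    {p \<in> patterns S A. \<not> (\<exists>y\<in>Z. (\<lambda>w. Some (y w)) |` dom p = p)}"

text \<open>
  Goedel numbers of patterns, for finite \<open>S\<close> and \<open>A\<close>.  Generators and symbols are numbered by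
  \<^const>\<open>to_nat_on\<close>, an unspecified bijection of a finite set with an initial segment of the
  naturals; recursive enumerability of a set of patterns does not depend on this numbering, as two
  numberings differ by a permutation of finitely many numbers.
\<close>

definition letter_code :: "'s set \<Rightarrow> 's \<times> bool \<Rightarrow> nat" where
  "letter_code S x = 2 * to_nat_on S (fst x) + of_bool (snd x)"

definition word_code :: "'s set \<Rightarrow> ('s \<times> bool) list \<Rightarrow> nat" where
  "word_code S w = list_encode (map (letter_code S) w)"

definition pattern_code :: "'s set \<Rightarrow> 'a set \<Rightarrow> (('s \<times> bool) list \<rightharpoonup> 'a) \<Rightarrow> nat" where
  "pattern_code S A p =
    set_encode ((\<lambda>(w, a). prod_encode (word_code S w, to_nat_on A a)) ` Map.graph p)"

lemma inj_on_word_code: "finite S \<Longrightarrow> inj_on (word_code S) (carrier (free_group S))"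
proof (rule inj_onI)
  fix u v assume S: "finite S"
    and uv: "u \<in> carrier (free_group S)" "v \<in> carrier (free_group S)" "word_code S u = word_code S v"
  have "inj_on (letter_code S) (S \<times> UNIV)"
  proof (rule inj_onI)
    fix x y assume xy: "x \<in> S \<times> (UNIV :: bool set)" "y \<in> S \<times> (UNIV :: bool set)"
      "letter_code S x = letter_code S y"
    have b: "snd x = snd y"
      using arg_cong[OF xy(3), of even] by (auto simp: letter_code_def split: if_splits)
    then have "to_nat_on S (fst x) = to_nat_on S (fst y)"
      using xy(3) by (simp add: letter_code_def)
    then have "fst x = fst y"
      using xy(1,2) inj_onD[OF inj_on_to_nat_on[OF countable_finite[OF S]]] by auto
    with b show "x = y" by (simp add: prod_eq_iff)
  qed
  moreover have "map (letter_code S) u = map (letter_code S) v"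
    using uv(3) by (simp add: word_code_def list_encode_eq)
  moreover have "set u \<union> set v \<subseteq> S \<times> UNIV"
    using uv by (auto simp: free_group_def)
  ultimately show "u = v"
    using inj_on_map_eq_map inj_on_subset by blast
qed

lemma inj_on_pattern_code:
  assumes "finite S" "finite A"
  shows "inj_on (pattern_code S A) (patterns S A)"
proof (rule inj_onI)
  fix p q assume pq: "p \<in> patterns S A" "q \<in> patterns S A" "pattern_code S A p = pattern_code S A q"
  let ?c = "\<lambda>(w, a). prod_encode (word_code S w, to_nat_on A a)"
  let ?D = "carrier (free_group S) \<times> A"
  have inj: "inj_on ?c ?D"
  proof (rule inj_onI)
    fix x y assume xy: "x \<in> ?D" "y \<in> ?D" "?c x = ?c y"
    then have "word_code S (fst x) = word_code S (fst y)"
      "to_nat_on A (snd x) = to_nat_on A (snd y)"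
      by (auto simp: case_prod_beta prod_encode_eq)
    then have "fst x = fst y" "snd x = snd y"
      using xy(1,2) inj_onD[OF inj_on_word_code[OF assms(1)]]
        inj_onD[OF inj_on_to_nat_on[OF countable_finite[OF assms(2)]]] by auto
    then show "x = y" by (rule prod_eqI)
  qed
  have sub: "Map.graph r \<subseteq> ?D" "finite (Map.graph r)" if "r \<in> patterns S A" for r
  proof -
    show "finite (Map.graph r)" using that by (simp add: patterns_def)
    show "Map.graph r \<subseteq> ?D" using that by (auto simp: patterns_def Map.graph_def ran_def)
  qed
  have "?c ` Map.graph p = ?c ` Map.graph q"
    using pq(3) sub(2)[OF pq(1)] sub(2)[OF pq(2)] unfolding pattern_code_def
    by (metis finite_imageI set_encode_eq)
  then have "Map.graph p = Map.graph q"
    using inj sub(1)[OF pq(1)] sub(1)[OF pq(2)] by (simp add: inj_on_image_eq_iff)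
  then have "p w = Some a \<longleftrightarrow> q w = Some a" for w a
    unfolding Map.graph_def set_eq_iff by auto
  then show "p = q"
    by (intro ext) (metis not_None_eq)
qed

definition effectively_closed ::
    "'s set \<Rightarrow> 'a set \<Rightarrow> (('s \<times> bool) list \<Rightarrow> 'a) set \<Rightarrow> bool" where
  "effectively_closed S A Z \<longleftrightarrow>
    recursively_enumerable (pattern_code S A ` forbidden_patterns S A Z)"

definition effective_subshift :: "('g, 'm) monoid_scheme \<Rightarrow> 'a set \<Rightarrow> ('g \<Rightarrow> 'a) set \<Rightarrow> bool" where
  "effective_subshift G A X \<longleftrightarrow>
    subshift G A X \<and>
    (\<exists>S. finite_generating_set G S \<and> effectively_closed S A (pullback G S X))"

end

theory Submission
  imports Defs
begin

text \<open>
  By compactness and equivariance the factor map is a block code: the symbol \<open>f x g\<close> depends only on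
  the symbols of \<open>x\<close> at \<open>g \<otimes> h\<close> for \<open>h\<close> in a finite window \<open>M\<close>.  Choose for each
  \<open>h \<in> M\<close> a word representing it.  A pattern \<open>p\<close> over \<open>B\<close> is then forbidden for the pullback of \<open>Y\<close>
  iff every pattern over \<open>A\<close> that the block code maps to \<open>p\<close> is forbidden for the pullback of \<open>X\<close>,
  and it suffices to test the finitely many such patterns supported on the translated window.  A
  bounded universal quantifier over a decidable condition preserves recursive enumerability: one
  runs the semi-decision procedure for \<open>X\<close> on these patterns one after the other, which terminates iff
  all runs do.
\<close>

section \<open>Computable functions and decidable predicates\<close>

definition computable :: "nat \<Rightarrow> (nat list \<Rightarrow> nat) \<Rightarrow> bool" where
  "computable k F \<longleftrightarrow> (\<exists>r. \<forall>xs. length xs = k \<longrightarrow> rec_eval r xs (F xs))"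

definition decidable :: "nat \<Rightarrow> (nat list \<Rightarrow> bool) \<Rightarrow> bool" where
  "decidable k P \<longleftrightarrow> computable k (\<lambda>xs. of_bool (P xs))"

definition semidecidable :: "nat \<Rightarrow> (nat list \<Rightarrow> bool) \<Rightarrow> bool" where
  "semidecidable k P \<longleftrightarrow> (\<exists>r. \<forall>xs. length xs = k \<longrightarrow> (\<exists>y. rec_eval r xs y) = P xs)"

text \<open>
  The argument list serves as an environment.  Rules for binders (recursion, sums, bounded
  quantifiers) put the bound variables in front, so an outer variable reappears as \<open>drop d xs ! i\<close>.
\<close>

named_theorems computable_intros

lemma computable_cong:
  "computable k F \<Longrightarrow> (\<And>xs. length xs = k \<Longrightarrow> F xs = G xs) \<Longrightarrow> computable k G"
  unfolding computable_def by metis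

lemma decidable_cong:
  "decidable k P \<Longrightarrow> (\<And>xs. length xs = k \<Longrightarrow> P xs = Q xs) \<Longrightarrow> decidable k Q"
  unfolding decidable_def by (erule computable_cong) simp

lemma semidecidable_cong:
  "semidecidable k P \<Longrightarrow> (\<And>xs. length xs = k \<Longrightarrow> P xs = Q xs) \<Longrightarrow> semidecidable k Q"
  unfolding semidecidable_def by metis

section \<open>Projections and composition\<close>

lemma computable_nth [computable_intros]: "i < k \<Longrightarrow> computable k (\<lambda>xs. xs ! i)"
  unfolding computable_def using rec_eval.proj by metis

lemma computable_drop_nth [computable_intros]: "d + i < k \<Longrightarrow> computable k (\<lambda>xs. drop d xs ! i)"
  using computable_nth[of "d + i" k] by (rule computable_cong) auto

text \<open>Nested binders produce nested \<open>drop\<close>s; merging them leaves a goal that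
  \<open>computable_drop_nth\<close> can solve.\<close>

lemma computable_drop_drop_nth [computable_intros]:
  "computable k (\<lambda>xs. drop (d + e) (H xs) ! i) \<Longrightarrow> computable k (\<lambda>xs. drop d (drop e (H xs)) ! i)"
  by simp

lemma rec_eval_Comp_map:
  assumes "\<And>xs. length xs = m \<Longrightarrow> rec_eval r xs (F xs)" "length Gs = m"
    and "list_all2 (\<lambda>g G. rec_eval g xs (G xs)) gs Gs"
  shows "rec_eval (Comp r gs) xs (F (map (\<lambda>G. G xs) Gs))"
  by (rule rec_eval.comp[where ys = "map (\<lambda>G. G xs) Gs"])
     (use assms in \<open>auto simp: list_all2_conv_all_nth\<close>)

lemma computable_list:
  assumes "\<forall>G\<in>set Gs. computable k G"
  shows "\<exists>gs. \<forall>xs. length xs = k \<longrightarrow> list_all2 (\<lambda>g G. rec_eval g xs (G xs)) gs Gs"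
  using assms
proof (induction Gs)
  case (Cons G Gs)
  then obtain g gs where "\<forall>xs. length xs = k \<longrightarrow> rec_eval g xs (G xs)"
    "\<forall>xs. length xs = k \<longrightarrow> list_all2 (\<lambda>g G. rec_eval g xs (G xs)) gs Gs"
    by (auto simp: computable_def)
  then show ?case by (intro exI[of _ "g # gs"]) simp
qed simp

lemma computable_comp:
  assumes F: "computable (length Gs) F" and Gs: "\<forall>G\<in>set Gs. computable k G"
  shows "computable k (\<lambda>xs. F (map (\<lambda>G. G xs) Gs))"
proof -
  obtain r where r: "\<And>xs. length xs = length Gs \<Longrightarrow> rec_eval r xs (F xs)"
    using F by (auto simp: computable_def)
  obtain gs where "\<forall>xs. length xs = k \<longrightarrow> list_all2 (\<lambda>g G. rec_eval g xs (G xs)) gs Gs"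
    using computable_list[OF Gs] by blast
  with r show ?thesis
    unfolding computable_def by (intro exI[of _ "Comp r gs"]) (auto intro!: rec_eval_Comp_map)
qed

text \<open>The inner terms are total, and functionality of evaluation forces the intermediate list
  to be their list of values; hence \<open>Comp r gs\<close> halts exactly when \<open>r\<close>
  halts on that list.\<close>

lemma semidecidable_comp:
  assumes P: "semidecidable (length Gs) P" and Gs: "\<forall>G\<in>set Gs. computable k G"
  shows "semidecidable k (\<lambda>xs. P (map (\<lambda>G. G xs) Gs))"
proof -
  obtain r where r: "\<And>xs. length xs = length Gs \<Longrightarrow> (\<exists>y. rec_eval r xs y) = P xs"
    using P by (auto simp: semidecidable_def)
  obtain gs where gs: "\<forall>xs. length xs = k \<longrightarrow> list_all2 (\<lambda>g G. rec_eval g xs (G xs)) gs Gs"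
    using computable_list[OF Gs] by blast
  have "(\<exists>y. rec_eval (Comp r gs) xs y) = P (map (\<lambda>G. G xs) Gs)" if xs: "length xs = k" for xs
  proof -
    have eval: "list_all2 (\<lambda>g y. rec_eval g xs y) gs (map (\<lambda>G. G xs) Gs)"
      using gs xs by (auto simp: list_all2_conv_all_nth)
    have "rec_eval (Comp r gs) xs y \<longleftrightarrow> rec_eval r (map (\<lambda>G. G xs) Gs) y" for y
    proof
      assume "rec_eval (Comp r gs) xs y"
      then obtain ys where ys: "list_all2 (\<lambda>g y. rec_eval g xs y) gs ys" "rec_eval r ys y"
        by (rule rec_eval_CompE)
      have "ys = map (\<lambda>G. G xs) Gs"
        using ys(1) eval rec_eval_functional
        by (intro nth_equalityI) (fastforce simp: list_all2_conv_all_nth)+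
      with ys show "rec_eval r (map (\<lambda>G. G xs) Gs) y" by simp
    qed (use eval in \<open>rule rec_eval.comp\<close>)
    then show ?thesis using r[of "map (\<lambda>G. G xs) Gs"] by simp
  qed
  then show ?thesis unfolding semidecidable_def by blast
qed

text \<open>Selecting or rearranging variables of the environment is composition with
  projections.\<close>

lemma computable_reindex:
  assumes "computable (length is) F" "\<forall>i\<in>set is. i < k"
  shows "computable k (\<lambda>xs. F (map (\<lambda>i. xs ! i) is))"
  using computable_comp[of "map (\<lambda>i xs. xs ! i) is" F k] assms
  by (simp add: computable_nth comp_def)

lemma semidecidable_reindex:
  assumes "semidecidable (length is) P" "\<forall>i\<in>set is. i < k"
  shows "semidecidable k (\<lambda>xs. P (map (\<lambda>i. xs ! i) is))"
  using semidecidable_comp[of "map (\<lambda>i xs. xs ! i) is" P k] assms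
  by (simp add: computable_nth comp_def)

lemma map_nth_upt: "length xs = k \<Longrightarrow> map (\<lambda>i. xs ! i) [d..<k] = drop d xs"
  by (auto intro: nth_equalityI)

lemma computable_drop:
  assumes "computable k F" shows "computable (d + k) (\<lambda>xs. F (drop d xs))"
proof -
  have "computable (d + k) (\<lambda>xs. F (map (\<lambda>i. xs ! i) [d..<d + k]))"
    by (rule computable_reindex) (use assms in auto)
  then show ?thesis by (rule computable_cong) (simp only: map_nth_upt)
qed

lemma semidecidable_drop:
  assumes "semidecidable k P" shows "semidecidable (d + k) (\<lambda>xs. P (drop d xs))"
proof -
  have "semidecidable (d + k) (\<lambda>xs. P (map (\<lambda>i. xs ! i) [d..<d + k]))"
    by (rule semidecidable_reindex) (use assms in auto)
  then show ?thesis by (rule semidecidable_cong) (simp only: map_nth_upt)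
qed

lemma computable_comp1:
  assumes "computable 1 (\<lambda>ys. f (ys ! 0))" "computable k G"
  shows "computable k (\<lambda>xs. f (G xs))"
  using computable_comp[of "[G]" "\<lambda>ys. f (ys ! 0)" k] assms by simp

lemma computable_comp2:
  assumes "computable 2 (\<lambda>ys. f (ys ! 0) (ys ! 1))" "computable k G" "computable k H"
  shows "computable k (\<lambda>xs. f (G xs) (H xs))"
  using computable_comp[of "[G, H]" "\<lambda>ys. f (ys ! 0) (ys ! 1)" k] assms by (simp add: numeral_2_eq_2)

section \<open>Primitive recursion and arithmetic\<close>

lemma computable_Suc [computable_intros]:
  assumes "computable k F" shows "computable k (\<lambda>xs. Suc (F xs))"
proof (rule computable_comp1[OF _ assms])
  show "computable 1 (\<lambda>ys. Suc (ys ! 0))"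
    unfolding computable_def
    by (rule exI[of _ Succ]) (auto simp: length_Suc_conv intro: rec_eval.succ)
qed

lemma computable_const [computable_intros]: "computable k (\<lambda>_. c)"
proof (induction c)
  case 0
  show ?case unfolding computable_def using rec_eval.zero by metis
qed (rule computable_Suc)

text \<open>\<open>PrimRec\<close> recurses on the first entry of its argument list and hands the
  step the counter and the previous value in front of the parameters, hence \<open>drop 2\<close>.
  Composing with \<open>N\<close> and all projections then puts \<open>N xs\<close> into the
  recursion slot.\<close>

lemma computable_rec_nat [computable_intros]:
  assumes N: "computable k N" and Z: "computable k Z"
    and S: "computable (k + 2) (\<lambda>ys. s (ys ! 0) (ys ! 1) (drop 2 ys))"
  shows "computable k (\<lambda>xs. rec_nat (Z xs) (\<lambda>m r. s m r xs) (N xs))"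
proof -
  obtain z t where z: "\<And>xs. length xs = k \<Longrightarrow> rec_eval z xs (Z xs)"
    and t: "\<And>ys. length ys = k + 2 \<Longrightarrow> rec_eval t ys (s (ys ! 0) (ys ! 1) (drop 2 ys))"
    using Z S by (auto simp: computable_def)
  have "rec_eval (PrimRec z t) (n # xs) (rec_nat (Z xs) (\<lambda>m r. s m r xs) n)"
    if "length xs = k" for n xs
  proof (induction n)
    case (Suc n)
    show ?case
      using t[of "n # rec_nat (Z xs) (\<lambda>m r. s m r xs) n # xs"] that
      by (auto intro!: rec_eval.primrec_Suc[OF Suc])
  qed (use z that in \<open>auto intro: rec_eval.primrec_0\<close>)
  then have "computable (Suc k) (\<lambda>ys. rec_nat (Z (tl ys)) (\<lambda>m r. s m r (tl ys)) (hd ys))"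
    unfolding computable_def by (intro exI[of _ "PrimRec z t"]) (auto simp: length_Suc_conv)
  then have "computable (length (N # map (\<lambda>i xs. xs ! i) [0..<k]))
      (\<lambda>ys. rec_nat (Z (tl ys)) (\<lambda>m r. s m r (tl ys)) (hd ys))" by simp
  from computable_comp[OF this, of k]
  have "computable k (\<lambda>xs. rec_nat (Z (map (\<lambda>i. xs ! i) [0..<k]))
      (\<lambda>m r. s m r (map (\<lambda>i. xs ! i) [0..<k])) (N xs))"
    using N by (simp add: computable_nth comp_def)
  then show ?thesis by (rule computable_cong) (simp only: map_nth_upt drop_0)
qed

lemma computable_add [computable_intros]:
  assumes "computable k F" "computable k G" shows "computable k (\<lambda>xs. F xs + G xs)"
proof (rule computable_comp2[OF _ assms])
  have "rec_nat m (\<lambda>_. Suc) n = m + n" for m n by (induction n) auto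
  moreover have "computable 2 (\<lambda>ys. rec_nat (ys ! 0) (\<lambda>_. Suc) (ys ! 1))"
    by (intro computable_intros; simp)
  ultimately show "computable 2 (\<lambda>ys. ys ! 0 + ys ! 1)" by simp
qed

lemma computable_sum [computable_intros]:
  assumes N: "computable k N" and F: "computable (Suc k) (\<lambda>ys. F (ys ! 0) (drop 1 ys))"
  shows "computable k (\<lambda>xs. \<Sum>i<N xs. F i xs)"
proof -
  \<comment> \<open>The recursion supplies counter and accumulator, while \<open>F\<close> expects
    only the counter in front of the parameters: this index list deletes position 1.\<close>
  have len: "length (0 # [2..<k + 2]) = Suc k" by (simp del: upt_Suc)
  have "computable (k + 2) (\<lambda>xs. (\<lambda>ys. F (ys ! 0) (drop 1 ys)) (map (\<lambda>i. xs ! i) (0 # [2..<k + 2])))"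
    by (rule computable_reindex[where F = "\<lambda>ys. F (ys ! 0) (drop 1 ys)"])
       (use F in \<open>auto simp: len simp del: upt_Suc\<close>)
  then have "computable (k + 2) (\<lambda>ys. F (ys ! 0) (drop 2 ys))"
    by (rule computable_cong) (simp add: map_nth_upt del: upt_Suc)
  then have "computable k (\<lambda>xs. rec_nat 0 (\<lambda>m r. r + F m xs) (N xs))"
    by (intro computable_intros N; simp)
  moreover have "rec_nat 0 (\<lambda>m r. r + F m xs) n = (\<Sum>i<n. F i xs)" for n xs
    by (induction n) auto
  ultimately show ?thesis by simp
qed

lemma computable_mult [computable_intros]:
  assumes "computable k F" "computable k G" shows "computable k (\<lambda>xs. F xs * G xs)"
proof (rule computable_comp2[OF _ assms])
  have "computable 2 (\<lambda>ys. \<Sum>i<ys ! 0. ys ! 1)"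
    by (intro computable_intros; simp)
  then show "computable 2 (\<lambda>ys. ys ! 0 * ys ! 1)" by simp
qed

lemma computable_power [computable_intros]:
  assumes "computable k F" "computable k G" shows "computable k (\<lambda>xs. F xs ^ G xs)"
proof (rule computable_comp2[OF _ assms])
  have "computable 2 (\<lambda>ys. rec_nat 1 (\<lambda>_ r. ys ! 0 * r) (ys ! 1))"
    by (intro computable_intros; simp)
  moreover have "rec_nat 1 (\<lambda>_ r. m * r) n = m ^ n" for m n :: nat by (induction n) auto
  ultimately show "computable 2 (\<lambda>ys. (ys ! 0) ^ (ys ! 1))" by simp
qed

lemma computable_diff [computable_intros]:
  assumes "computable k F" "computable k G" shows "computable k (\<lambda>xs. F xs - G xs)"
proof (rule computable_comp2[OF _ assms])
  have pred: "computable k (\<lambda>xs. F xs - 1)" if "computable k F" for k F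
  proof (rule computable_comp1[OF _ that])
    have "computable 1 (\<lambda>ys. rec_nat 0 (\<lambda>m _. m) (ys ! 0))"
      by (intro computable_intros; simp)
    moreover have "rec_nat 0 (\<lambda>m _. m) n = n - 1" for n :: nat by (cases n) auto
    ultimately show "computable 1 (\<lambda>ys. ys ! 0 - 1)" by simp
  qed
  have "computable 2 (\<lambda>ys. rec_nat (ys ! 0) (\<lambda>_ r. r - 1) (ys ! 1))"
    by (intro computable_intros pred; simp)
  moreover have "rec_nat m (\<lambda>_ r. r - 1) n = m - n" for m n :: nat by (induction n) auto
  ultimately show "computable 2 (\<lambda>ys. ys ! 0 - ys ! 1)" by simp
qed

section \<open>Decidable predicates and bounded quantifiers\<close>

lemma decidable_less [computable_intros]:
  assumes "computable k F" "computable k G" shows "decidable k (\<lambda>xs. F xs < G xs)"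
proof -
  \<comment> \<open>With truncated subtraction, \<open>1 - (1 - n)\<close> is 0 for
    \<open>n = 0\<close> and 1 otherwise.\<close>
  have "computable k (\<lambda>xs. 1 - (1 - (G xs - F xs)))"
    by (intro computable_intros assms)
  then show ?thesis unfolding decidable_def by (rule computable_cong) auto
qed

lemma decidable_not [computable_intros]:
  assumes "decidable k P" shows "decidable k (\<lambda>xs. \<not> P xs)"
proof -
  have "computable k (\<lambda>xs. 1 - of_bool (P xs))"
    using assms unfolding decidable_def by (intro computable_intros)
  then show ?thesis unfolding decidable_def by (rule computable_cong) auto
qed

lemma decidable_conj [computable_intros]:
  assumes "decidable k P" "decidable k Q" shows "decidable k (\<lambda>xs. P xs \<and> Q xs)"
proof -
  have "computable k (\<lambda>xs. of_bool (P xs) * of_bool (Q xs))"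
    using assms unfolding decidable_def by (intro computable_intros)
  then show ?thesis unfolding decidable_def by (rule computable_cong) auto
qed

lemma decidable_disj [computable_intros]:
  assumes "decidable k P" "decidable k Q" shows "decidable k (\<lambda>xs. P xs \<or> Q xs)"
proof -
  have "decidable k (\<lambda>xs. \<not> (\<not> P xs \<and> \<not> Q xs))"
    by (intro computable_intros assms)
  then show ?thesis by simp
qed

lemma decidable_imp [computable_intros]:
  assumes "decidable k P" "decidable k Q" shows "decidable k (\<lambda>xs. P xs \<longrightarrow> Q xs)"
  using decidable_disj[OF decidable_not[OF assms(1)] assms(2)] by (rule decidable_cong) blast

lemma decidable_le [computable_intros]:
  assumes "computable k F" "computable k G" shows "decidable k (\<lambda>xs. F xs \<le> G xs)"
  using decidable_less[OF assms(1) computable_Suc[OF assms(2)]] by (simp add: less_Suc_eq_le)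

lemma decidable_eq [computable_intros]:
  assumes "computable k F" "computable k G" shows "decidable k (\<lambda>xs. F xs = G xs)"
  using decidable_conj[OF decidable_le[OF assms] decidable_le[OF assms(2,1)]]
  by (simp add: order_eq_iff)

lemma decidable_const [computable_intros]: "decidable k (\<lambda>_. c)"
  unfolding decidable_def by (intro computable_intros)

lemma computable_if [computable_intros]:
  assumes "decidable k P" "computable k F" "computable k G"
  shows "computable k (\<lambda>xs. if P xs then F xs else G xs)"
proof -
  have "computable k (\<lambda>xs. of_bool (P xs) * F xs + (1 - of_bool (P xs)) * G xs)"
    using assms unfolding decidable_def by (intro computable_intros)
  then show ?thesis by (rule computable_cong) auto
qed

lemma computable_of_bool [computable_intros]:
  "decidable k P \<Longrightarrow> computable k (\<lambda>xs. of_bool (P xs))"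
  by (simp add: decidable_def)

lemma decidable_bex [computable_intros]:
  assumes "computable k N" "decidable (Suc k) (\<lambda>ys. P (ys ! 0) (drop 1 ys))"
  shows "decidable k (\<lambda>xs. \<exists>i<N xs. P i xs)"
proof -
  have "decidable k (\<lambda>xs. 0 < (\<Sum>i<N xs. of_bool (P i xs) :: nat))"
    by (intro computable_intros assms)
  moreover have "0 < (\<Sum>i<n. of_bool (P i xs) :: nat) \<longleftrightarrow> (\<exists>i<n. P i xs)" for n xs
    by (induction n) (auto simp: less_Suc_eq)
  ultimately show ?thesis by simp
qed

lemma decidable_ball [computable_intros]:
  assumes "computable k N" "decidable (Suc k) (\<lambda>ys. P (ys ! 0) (drop 1 ys))"
  shows "decidable k (\<lambda>xs. \<forall>i<N xs. P i xs)"
proof -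
  have "decidable k (\<lambda>xs. \<not> (\<exists>i<N xs. \<not> P i xs))"
    by (intro computable_intros assms)
  then show ?thesis by simp
qed

text \<open>\<open>T\<close> is a fixed parameter of arbitrary type, so the quantifier unfolds into
  a finite conjunction of tests chosen in advance, and elements of \<open>T\<close> are never
  coded.\<close>

lemma decidable_finite_ball:
  "finite T \<Longrightarrow> (\<And>t. t \<in> T \<Longrightarrow> decidable k (P t)) \<Longrightarrow> decidable k (\<lambda>xs. \<forall>t\<in>T. P t xs)"
  by (induction T rule: finite_induct) (auto intro: computable_intros)

lemma decidable_finite_bex:
  "finite T \<Longrightarrow> (\<And>t. t \<in> T \<Longrightarrow> decidable k (P t)) \<Longrightarrow> decidable k (\<lambda>xs. \<exists>t\<in>T. P t xs)"
  by (induction T rule: finite_induct) (auto intro: computable_intros)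

lemma computable_finite_sum:
  "finite T \<Longrightarrow> (\<And>t. t \<in> T \<Longrightarrow> computable k (F t)) \<Longrightarrow> computable k (\<lambda>xs. \<Sum>t\<in>T. F t xs)"
  by (induction T rule: finite_induct) (auto intro: computable_intros)

section \<open>Semidecidable predicates\<close>

lemma semidecidable_conj:
  assumes P: "semidecidable k P" and Q: "semidecidable k Q"
  shows "semidecidable k (\<lambda>xs. P xs \<and> Q xs)"
proof -
  obtain f g where f: "\<And>xs. length xs = k \<Longrightarrow> (\<exists>y. rec_eval f xs y) = P xs"
    and g: "\<And>xs. length xs = k \<Longrightarrow> (\<exists>y. rec_eval g xs y) = Q xs"
    using P Q by (auto simp: semidecidable_def)
  \<comment> \<open>\<open>Zero\<close> has a value on every argument list, so the composite halts
    exactly when both inner terms do.\<close>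
  have "(\<exists>y. rec_eval (Comp Zero [f, g]) xs y) \<longleftrightarrow> (\<exists>y. rec_eval f xs y) \<and> (\<exists>y. rec_eval g xs y)" for xs
  proof
    assume "\<exists>y. rec_eval (Comp Zero [f, g]) xs y"
    then show "(\<exists>y. rec_eval f xs y) \<and> (\<exists>y. rec_eval g xs y)"
      by (auto elim!: rec_eval_CompE simp: list_all2_Cons1)
  next
    assume "(\<exists>y. rec_eval f xs y) \<and> (\<exists>y. rec_eval g xs y)"
    then obtain y z where "list_all2 (\<lambda>g y. rec_eval g xs y) [f, g] [y, z]" by auto
    then show "\<exists>y. rec_eval (Comp Zero [f, g]) xs y" using rec_eval.comp rec_eval.zero by blast
  qed
  with f g show ?thesis
    unfolding semidecidable_def by (intro exI[of _ "Comp Zero [f, g]"]) simp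
qed

text \<open>\<open>Mu\<close> searches over a dummy variable: if \<open>P\<close> holds,
  \<open>r\<close> is constantly 0 in it and the search stops at once; otherwise \<open>r\<close> is
  constantly 1 and the search never ends.\<close>

lemma semidecidable_decidable:
  assumes "decidable k P" shows "semidecidable k P"
proof -
  have "computable k (\<lambda>ys. 1 - of_bool (P ys))"
    by (intro computable_intros assms)
  then have "computable (Suc k) (\<lambda>ys. 1 - of_bool (P (drop 1 ys)))"
    using computable_drop[of k _ 1] by simp
  then obtain r where r: "\<And>ys. length ys = Suc k \<Longrightarrow> rec_eval r ys (1 - of_bool (P (drop 1 ys)))"
    by (auto simp: computable_def)
  have "(\<exists>y. rec_eval (Mu r) xs y) = P xs" if xs: "length xs = k" for xs
  proof
    assume "\<exists>y. rec_eval (Mu r) xs y"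
    then obtain n where "rec_eval r (n # xs) 0" by (auto elim: rec_eval_MuE)
    moreover have "rec_eval r (n # xs) (1 - of_bool (P xs))" using r[of "n # xs"] xs by simp
    ultimately have "0 = (1 - of_bool (P xs) :: nat)" by (rule rec_eval_functional)
    then show "P xs" by (cases "P xs") auto
  next
    assume "P xs"
    then have "rec_eval r (0 # xs) 0" using r[of "0 # xs"] xs by simp
    then show "\<exists>y. rec_eval (Mu r) xs y" by (blast intro: rec_eval.mu)
  qed
  then show ?thesis unfolding semidecidable_def by blast
qed

text \<open>A primitive recursion with partial step function diverges as soon as one of its steps does.\<close>

lemma semidecidable_ball:
  assumes N: "computable k N" and P: "semidecidable (Suc k) (\<lambda>ys. P (ys ! 0) (drop 1 ys))"
  shows "semidecidable k (\<lambda>xs. \<forall>i<N xs. P i xs)"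
proof -
  have len: "length (0 # [2..<k + 2]) = Suc k" by (simp del: upt_Suc)
  have "semidecidable (k + 2) (\<lambda>xs. (\<lambda>ys. P (ys ! 0) (drop 1 ys)) (map (\<lambda>i. xs ! i) (0 # [2..<k + 2])))"
    by (rule semidecidable_reindex[where P = "\<lambda>ys. P (ys ! 0) (drop 1 ys)"])
       (use P in \<open>auto simp: len simp del: upt_Suc\<close>)
  then have "semidecidable (k + 2) (\<lambda>ys. P (ys ! 0) (drop 2 ys))"
    by (rule semidecidable_cong) (simp add: map_nth_upt del: upt_Suc)
  then obtain t where t: "\<And>ys. length ys = k + 2 \<Longrightarrow> (\<exists>y. rec_eval t ys y) = P (ys ! 0) (drop 2 ys)"
    by (auto simp: semidecidable_def)
  have "(\<exists>y. rec_eval (PrimRec Zero t) (n # xs) y) \<longleftrightarrow> (\<forall>i<n. P i xs)"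
    if xs: "length xs = k" for n xs
  proof (induction n)
    case 0
    show ?case using rec_eval.primrec_0 rec_eval.zero by blast
  next
    case (Suc n)
    \<comment> \<open>Termination of a step is governed by the counter and the parameters alone, so
      this holds for every accumulated value \<open>r\<close>.\<close>
    have t': "(\<exists>y. rec_eval t (n # r # xs) y) = P n xs" for r
      using t[of "n # r # xs"] xs by simp
    have "(\<exists>y. rec_eval (PrimRec Zero t) (Suc n # xs) y) \<longleftrightarrow>
        (\<exists>y. rec_eval (PrimRec Zero t) (n # xs) y) \<and> P n xs"
      using t' by (blast elim: rec_eval_PrimRec_SucE intro: rec_eval.primrec_Suc)
    with Suc show ?case by (auto simp: less_Suc_eq)
  qed
  then have "semidecidable (length (N # map (\<lambda>i xs. xs ! i) [0..<k])) (\<lambda>ys. \<forall>i<hd ys. P i (tl ys))"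
    unfolding semidecidable_def
    by (intro exI[of _ "PrimRec Zero t"] allI impI) (clarsimp simp: length_Suc_conv)
  from semidecidable_comp[OF this, of k]
  have "semidecidable k (\<lambda>xs. \<forall>i<N xs. P i (map (\<lambda>i. xs ! i) [0..<k]))"
    using N by (simp add: computable_nth comp_def)
  then show ?thesis by (rule semidecidable_cong) (simp only: map_nth_upt drop_0)
qed

text \<open>The implication is a bounded quantifier with \<open>of_bool (P xs)\<close> instances:
  the procedure for \<open>Q\<close> runs once if \<open>P\<close> holds and not at all
  otherwise.\<close>

lemma semidecidable_imp:
  assumes P: "decidable k P" and Q: "semidecidable k Q"
  shows "semidecidable k (\<lambda>xs. P xs \<longrightarrow> Q xs)"
proof -
  have "semidecidable k (\<lambda>xs. \<forall>i<(of_bool (P xs) :: nat). Q xs)"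
    by (rule semidecidable_ball)
       (use P semidecidable_drop[OF Q, of 1] in \<open>auto intro: computable_intros\<close>)
  then show ?thesis by (rule semidecidable_cong) simp
qed

lemma recursively_enumerable_iff_semidecidable:
  "recursively_enumerable U \<longleftrightarrow> semidecidable 1 (\<lambda>xs. xs ! 0 \<in> U)"
proof -
  have "(\<forall>xs. length xs = 1 \<longrightarrow> (\<exists>y. rec_eval f xs y) = (xs ! 0 \<in> U)) \<longleftrightarrow> U = {n. \<exists>y. rec_eval f [n] y}" for f
    by (auto simp: length_Suc_conv)
  then show ?thesis unfolding recursively_enumerable_def semidecidable_def by simp
qed

section \<open>Computing with codes\<close>

lemma computable_triangle [computable_intros]:
  assumes "computable k F" shows "computable k (\<lambda>xs. triangle (F xs))"
proof -
  have "computable k (\<lambda>xs. \<Sum>i<Suc (F xs). i)"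
    by (intro computable_intros assms; simp)
  moreover have "(\<Sum>i<Suc n. i) = triangle n" for n by (induction n) auto
  ultimately show ?thesis by simp
qed

lemma computable_prod_encode [computable_intros]:
  "computable k F \<Longrightarrow> computable k G \<Longrightarrow> computable k (\<lambda>xs. prod_encode (F xs, G xs))"
  unfolding prod_encode_def by (simp add: computable_intros)

text \<open>A bounded search written as a sum: a pair code dominates both components, so the first
  component is the only index in range that passes the test, and the sum returns it.\<close>

lemma computable_fst_prod_decode [computable_intros]:
  assumes "computable k F" shows "computable k (\<lambda>xs. fst (prod_decode (F xs)))"
proof (rule computable_comp1[OF _ assms])
  have "computable 1 (\<lambda>ys. \<Sum>i<Suc (ys ! 0). if \<exists>j<Suc (ys ! 0). prod_encode (i, j) = ys ! 0 then i else 0)"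
    by (intro computable_intros; simp)
  moreover have "(\<Sum>i<Suc z. if \<exists>j<Suc z. prod_encode (i, j) = z then i else 0) = fst (prod_decode z)" for z
  proof -
    obtain a b where z: "z = prod_encode (a, b)" by (metis prod_decode_inverse surj_pair)
    have "(\<exists>j<Suc z. prod_encode (i, j) = z) \<longleftrightarrow> i = a" for i
      unfolding z using le_prod_encode_2[of b a] by (auto simp: prod_encode_eq less_Suc_eq_le)
    moreover have "a < Suc z" unfolding z using le_prod_encode_1[of a b] by simp
    ultimately show ?thesis using z by simp
  qed
  ultimately show "computable 1 (\<lambda>ys. fst (prod_decode (ys ! 0)))" by simp
qed

lemma computable_snd_prod_decode [computable_intros]:
  assumes "computable k F" shows "computable k (\<lambda>xs. snd (prod_decode (F xs)))"
proof (rule computable_comp1[OF _ assms])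
  have "computable 1 (\<lambda>ys. \<Sum>j<Suc (ys ! 0). if \<exists>i<Suc (ys ! 0). prod_encode (i, j) = ys ! 0 then j else 0)"
    by (intro computable_intros; simp)
  moreover have "(\<Sum>j<Suc z. if \<exists>i<Suc z. prod_encode (i, j) = z then j else 0) = snd (prod_decode z)" for z
  proof -
    obtain a b where z: "z = prod_encode (a, b)" by (metis prod_decode_inverse surj_pair)
    have "(\<exists>i<Suc z. prod_encode (i, j) = z) \<longleftrightarrow> j = b" for j
      unfolding z using le_prod_encode_1[of a b] by (auto simp: prod_encode_eq less_Suc_eq_le)
    moreover have "b < Suc z" unfolding z using le_prod_encode_2[of b a] by simp
    ultimately show ?thesis using z by simp
  qed
  ultimately show "computable 1 (\<lambda>ys. snd (prod_decode (ys ! 0)))" by simp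
qed

lemma decidable_comp1:
  assumes "decidable 1 (\<lambda>ys. P (ys ! 0))" "computable k G"
  shows "decidable k (\<lambda>xs. P (G xs))"
  using assms unfolding decidable_def by (rule computable_comp1)

lemma decidable_comp2:
  assumes "decidable 2 (\<lambda>ys. P (ys ! 0) (ys ! 1))" "computable k G" "computable k H"
  shows "decidable k (\<lambda>xs. P (G xs) (H xs))"
  using assms unfolding decidable_def by (rule computable_comp2)

lemma decidable_even [computable_intros]:
  assumes "computable k F" shows "decidable k (\<lambda>xs. even (F xs))"
proof (rule decidable_comp1[OF _ assms])
  have "decidable 1 (\<lambda>ys. \<exists>d<Suc (ys ! 0). ys ! 0 = 2 * d)"
    by (intro computable_intros; simp)
  then show "decidable 1 (\<lambda>ys. even (ys ! 0))" by (rule decidable_cong) (auto elim!: evenE)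
qed

text \<open>Membership of \<open>i\<close> means that binary digit \<open>i\<close> of
  \<open>n\<close> is 1, i.e. that \<open>n div 2 ^ i\<close> has the form \<open>2 * d + 1\<close>.
  Two inequalities express this value of the quotient, so a bounded search for \<open>d\<close>
  replaces division.\<close>

lemma decidable_mem_set_decode [computable_intros]:
  assumes "computable k F" "computable k G"
  shows "decidable k (\<lambda>xs. F xs \<in> set_decode (G xs))"
proof -
  have *: "decidable 2 (\<lambda>ys. \<exists>d<Suc (ys ! 1).
      (2 * d + 1) * 2 ^ (ys ! 0) \<le> ys ! 1 \<and> ys ! 1 < (2 * d + 2) * 2 ^ (ys ! 0))"
    by (intro computable_intros; simp)
  have "(\<exists>d<Suc n. (2 * d + 1) * 2 ^ i \<le> n \<and> n < (2 * d + 2) * 2 ^ i) \<longleftrightarrow> i \<in> set_decode n" for i n :: nat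
  proof -
    have "(2 * d + 1) * 2 ^ i \<le> n \<and> n < (2 * d + 2) * 2 ^ i \<longleftrightarrow> n div 2 ^ i = 2 * d + 1" for d
    proof -
      have "n div 2 ^ i = 2 * d + 1 \<longleftrightarrow> 2 * d + 1 \<le> n div 2 ^ i \<and> n div 2 ^ i < 2 * d + 2" by auto
      then show ?thesis
        by (simp only: less_eq_div_iff_mult_less_eq div_less_iff_less_mult zero_less_power zero_less_numeral)
    qed
    moreover have "d < Suc n" if "n div 2 ^ i = 2 * d + 1" for d
      using div_le_dividend[of n "2 ^ i"] that by linarith
    ultimately show ?thesis unfolding set_decode_def by (auto elim!: oddE)
  qed
  with * have "decidable 2 (\<lambda>ys. ys ! 0 \<in> set_decode (ys ! 1))" by simp
  then show ?thesis
    by (rule decidable_comp2[OF _ assms])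
qed

section \<open>Folds over coded lists\<close>

lemma length_le_list_encode: "length l \<le> list_encode l"
proof (induction l)
  case (Cons x l)
  then show ?case using le_prod_encode_2[of "list_encode l" x] by simp
qed simp

text \<open>One step of a loop whose state pairs the code of the remaining list with the
  accumulator. Code 0 is the empty list, and \<open>c - 1\<close> is the pair of head and tail code.
  States with an empty list are fixed, so surplus iterations are harmless.\<close>

definition fold_step :: "(nat \<Rightarrow> nat \<Rightarrow> nat) \<Rightarrow> nat \<Rightarrow> nat" where
  "fold_step g z = (let c = fst (prod_decode z) in if c = 0 then z else
    prod_encode (snd (prod_decode (c - 1)), g (fst (prod_decode (c - 1))) (snd (prod_decode z))))"

lemma funpow_fold_step:
  "length l \<le> n \<Longrightarrow>
    (fold_step g ^^ n) (prod_encode (list_encode l, z)) = prod_encode (0, fold g l z)"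
proof (induction n arbitrary: l z)
  case (Suc n)
  show ?case
  proof (cases l)
    case Nil
    then show ?thesis using Suc.IH[of "[]" z] by (simp add: fold_step_def funpow_Suc_right del: funpow.simps)
  next
    case (Cons x l')
    then show ?thesis using Suc.IH[of l' "g x z"] Suc.prems
      by (simp add: fold_step_def funpow_Suc_right del: funpow.simps)
  qed
qed simp

lemma computable_fold_list_decode:
  assumes g: "computable 2 (\<lambda>ys. g (ys ! 0) (ys ! 1))"
    and C: "computable k C" and Z: "computable k Z"
  shows "computable k (\<lambda>xs. fold g (list_decode (C xs)) (Z xs))"
proof -
  \<comment> \<open>A list is no longer than its code, so \<open>C xs\<close> iterations exhaust
    it.\<close>
  have "computable k (\<lambda>xs. snd (prod_decode (rec_nat (prod_encode (C xs, Z xs)) (\<lambda>_. fold_step g) (C xs))))"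
    unfolding fold_step_def Let_def
    by (intro computable_intros computable_comp2[OF g] C Z; simp)
  moreover have "rec_nat z (\<lambda>_. h) n = (h ^^ n) z" for z n :: nat and h
    by (induction n) auto
  moreover have "snd (prod_decode ((fold_step g ^^ c) (prod_encode (c, z)))) = fold g (list_decode c) z" for c z
    using funpow_fold_step[of "list_decode c" c g z] length_le_list_encode[of "list_decode c"] by simp
  ultimately show ?thesis by simp
qed

text \<open>\<open>foldr\<close> is \<open>fold\<close> along the reversed list, and the code of the
  reversed list is itself obtained by a fold that conses onto 0.\<close>

lemma computable_foldr_list_decode:
  assumes g: "computable 2 (\<lambda>ys. g (ys ! 0) (ys ! 1))"
    and C: "computable k C" and Z: "computable k Z"
  shows "computable k (\<lambda>xs. foldr g (list_decode (C xs)) (Z xs))"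
proof -
  let ?cons = "\<lambda>x c. Suc (prod_encode (x, c))"
  have "fold ?cons l (list_encode l') = list_encode (rev l @ l')" for l l'
  proof (induction l arbitrary: l')
    case (Cons a l)
    then show ?case using Cons[of "a # l'"] by simp
  qed simp
  from this[of _ "[]"] have rev: "list_decode (fold ?cons l 0) = rev l" for l by simp
  have "computable k (\<lambda>xs. fold g (list_decode (fold ?cons (list_decode (C xs)) 0)) (Z xs))"
    by (intro computable_fold_list_decode g C Z computable_intros; simp)
  then show ?thesis by (simp add: rev foldr_conv_fold)
qed

lemma decidable_ball_list_decode:
  assumes C: "computable k C"
  shows "decidable k (\<lambda>xs. \<forall>l\<in>set (list_decode (C xs)). l < N)"
proof -
  have eq: "foldr (\<lambda>l r. if l < N then r else 0) ls 1 = (of_bool (\<forall>l\<in>set ls. l < N) :: nat)" for ls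
    by (induction ls) auto
  have "decidable k (\<lambda>xs. foldr (\<lambda>l r. if l < N then r else 0) (list_decode (C xs)) (1::nat) = 1)"
    by (intro computable_intros computable_foldr_list_decode C; simp)
  then show ?thesis by (rule decidable_cong) (simp only: eq of_bool_eq_1_iff)
qed

section \<open>Words and patterns as numbers\<close>

definition inv_code :: "nat \<Rightarrow> nat" where
  "inv_code x = (if even x then Suc x else x - 1)"

text \<open>The counterpart of \<open>push_letter\<close> under \<open>word_code\<close>: 0 is the
  empty word, and \<open>c - 1\<close> decodes to head letter and tail of a nonempty one.\<close>

definition push_code :: "nat \<Rightarrow> nat \<Rightarrow> nat" where
  "push_code x c = (if c = 0 \<or> fst (prod_decode (c - 1)) \<noteq> inv_code x
    then Suc (prod_encode (x, c)) else snd (prod_decode (c - 1)))"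

definition mult_code :: "nat \<Rightarrow> nat \<Rightarrow> nat" where
  "mult_code c d = foldr push_code (list_decode c) d"

text \<open>A word is reduced iff multiplying it by the empty word does not change it.\<close>

definition is_word_code :: "nat \<Rightarrow> nat \<Rightarrow> bool" where
  "is_word_code s c \<longleftrightarrow> (\<forall>l\<in>set (list_decode c). l < 2 * s) \<and> mult_code c 0 = c"

text \<open>Members of \<open>set_decode n\<close> are below \<open>n\<close>, so the bounds make
  the quantifiers decidable without restricting them. The second conjunct makes the coded graph
  single-valued.\<close>

definition is_pattern_code :: "nat \<Rightarrow> nat \<Rightarrow> nat \<Rightarrow> bool" where
  "is_pattern_code s a n \<longleftrightarrow>
    (\<forall>e<n. e \<in> set_decode n \<longrightarrow> is_word_code s (fst (prod_decode e)) \<and> snd (prod_decode e) < a) \<and>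
    (\<forall>e<n. \<forall>e'<n. e \<in> set_decode n \<and> e' \<in> set_decode n \<and> fst (prod_decode e) = fst (prod_decode e') \<longrightarrow> e = e')"

text \<open>
  An element of \<open>T\<close> is a local rule: a set of pairs (code of a window word, symbol), and the output symbol.
\<close>

definition factor_consistent :: "((nat \<times> nat) set \<times> nat) set \<Rightarrow> nat \<Rightarrow> nat \<Rightarrow> bool" where
  "factor_consistent T n q \<longleftrightarrow> (\<forall>e<n. e \<in> set_decode n \<longrightarrow>
    (\<exists>t\<in>T. snd (prod_decode e) = snd t \<and>
      (\<forall>m\<in>fst t. prod_encode (mult_code (fst (prod_decode e)) (fst m), snd m) \<in> set_decode q)))"

text \<open>
  Exceeds the code of every pattern supported on the window translates of the pattern with code \<open>n\<close>:
  \<open>D\<close> holds the codes of the window words, and \<open>e\<close> ranges over all possible members of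
  \<^term>\<open>set_decode n\<close>.
\<close>

definition preimage_bound :: "nat set \<Rightarrow> nat \<Rightarrow> nat \<Rightarrow> nat" where
  "preimage_bound D a n = 2 ^ Suc (\<Sum>e<n. \<Sum>m\<in>D. prod_encode (mult_code (fst (prod_decode e)) m, a))"

section \<open>Computability of the operations on codes\<close>

lemma computable_mult_code [computable_intros]:
  assumes "computable k F" "computable k G" shows "computable k (\<lambda>xs. mult_code (F xs) (G xs))"
  unfolding mult_code_def
proof (rule computable_foldr_list_decode[OF _ assms])
  show "computable 2 (\<lambda>ys. push_code (ys ! 0) (ys ! 1))"
    unfolding push_code_def inv_code_def by (intro computable_intros; simp)
qed

lemma decidable_is_word_code [computable_intros]:
  "computable k F \<Longrightarrow> decidable k (\<lambda>xs. is_word_code s (F xs))"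
  unfolding is_word_code_def by (intro computable_intros decidable_ball_list_decode)

lemma decidable_is_pattern_code [computable_intros]:
  assumes "computable k F" shows "decidable k (\<lambda>xs. is_pattern_code s a (F xs))"
proof (rule decidable_comp1[OF _ assms])
  show "decidable 1 (\<lambda>ys. is_pattern_code s a (ys ! 0))"
    unfolding is_pattern_code_def by (intro computable_intros; simp)
qed

lemma decidable_factor_consistent [computable_intros]:
  assumes T: "finite T" "\<And>t. t \<in> T \<Longrightarrow> finite (fst t)"
    and F: "computable k F" "computable k G"
  shows "decidable k (\<lambda>xs. factor_consistent T (F xs) (G xs))"
proof (rule decidable_comp2[OF _ F])
  show "decidable 2 (\<lambda>ys. factor_consistent T (ys ! 0) (ys ! 1))"
    unfolding factor_consistent_def
    by (intro computable_intros decidable_finite_bex decidable_finite_ball T; simp)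
qed

lemma computable_preimage_bound [computable_intros]:
  assumes D: "finite D" and F: "computable k F"
  shows "computable k (\<lambda>xs. preimage_bound D a (F xs))"
proof (rule computable_comp1[OF _ F])
  show "computable 1 (\<lambda>ys. preimage_bound D a (ys ! 0))"
    unfolding preimage_bound_def
    by (intro computable_intros computable_finite_sum D; simp)
qed

text \<open>Membership in \<open>U\<close> is the only test that may fail to halt, and it stands
  under a bounded quantifier with a decidable guard.\<close>

lemma recursively_enumerable_factor:
  assumes U: "recursively_enumerable U"
    and fin: "finite T" "\<And>t. t \<in> T \<Longrightarrow> finite (fst t)" "finite D"
  shows "recursively_enumerable {n. is_pattern_code s b n \<and> (\<forall>q<preimage_bound D a n.
    is_pattern_code s a q \<and> factor_consistent T n q \<longrightarrow> q \<in> U)}"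
proof -
  have "semidecidable 2 (\<lambda>ys. ys ! 0 \<in> U)"
    using semidecidable_comp[of "[\<lambda>xs. xs ! 0]" "\<lambda>xs. xs ! 0 \<in> U" 2] U
    by (simp add: recursively_enumerable_iff_semidecidable computable_nth)
  moreover have "decidable 2 (\<lambda>ys. is_pattern_code s a (ys ! 0) \<and> factor_consistent T (drop 1 ys ! 0) (ys ! 0))"
    by (intro computable_intros fin; simp)
  ultimately have "semidecidable (Suc 1) (\<lambda>ys. is_pattern_code s a (ys ! 0) \<and>
      factor_consistent T (drop 1 ys ! 0) (ys ! 0) \<longrightarrow> ys ! 0 \<in> U)"
    using semidecidable_imp by (simp add: numeral_2_eq_2)
  then have "semidecidable 1 (\<lambda>xs. \<forall>q<preimage_bound D a (xs ! 0).
      is_pattern_code s a q \<and> factor_consistent T (xs ! 0) q \<longrightarrow> q \<in> U)"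
    by (rule semidecidable_ball[rotated]) (intro computable_intros fin; simp)
  moreover have "semidecidable 1 (\<lambda>xs. is_pattern_code s b (xs ! 0))"
    by (intro semidecidable_decidable computable_intros; simp)
  ultimately have "semidecidable 1 (\<lambda>xs. is_pattern_code s b (xs ! 0) \<and> (\<forall>q<preimage_bound D a (xs ! 0).
      is_pattern_code s a q \<and> factor_consistent T (xs ! 0) q \<longrightarrow> q \<in> U))"
    by (rule semidecidable_conj[rotated])
  then show ?thesis by (simp add: recursively_enumerable_iff_semidecidable)
qed

section \<open>Codes of words and patterns\<close>

lemma to_nat_on_less_card: "finite A \<Longrightarrow> a \<in> A \<Longrightarrow> to_nat_on A a < card A"
  using to_nat_on_finite[of A] by (auto simp: bij_betw_def)

text \<open>Surjectivity onto an initial segment is what allows \<open>is_word_code\<close> to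
  recognise letters by the bound \<open>2 * card S\<close>.\<close>

lemma bij_betw_letter_code:
  assumes "finite S" shows "bij_betw (letter_code S) (S \<times> UNIV) {..<2 * card S}"
  unfolding bij_betw_def
proof (intro conjI equalityI subsetI)
  show "inj_on (letter_code S) (S \<times> UNIV)"
  proof (rule inj_onI)
    fix x y assume xy: "x \<in> S \<times> UNIV" "y \<in> S \<times> UNIV" "letter_code S x = letter_code S y"
    have "snd x = snd y"
      using arg_cong[OF xy(3), of even] by (auto simp: letter_code_def split: if_splits)
    moreover from this have "fst x = fst y"
      using xy inj_onD[OF inj_on_to_nat_on[OF countable_finite[OF assms]]]
      by (auto simp: letter_code_def)
    ultimately show "x = y" by (rule prod_eqI[rotated])
  qed
next
  fix n assume "n \<in> letter_code S ` (S \<times> UNIV)"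
  then show "n \<in> {..<2 * card S}"
    using to_nat_on_less_card[OF assms] by (force simp: letter_code_def)
next
  fix n assume "n \<in> {..<2 * card S}"
  then have "n div 2 \<in> to_nat_on S ` S"
    using to_nat_on_finite[OF assms] by (auto simp: bij_betw_def)
  then obtain s where "s \<in> S" "to_nat_on S s = n div 2" by auto
  then have "letter_code S (s, odd n) = n" by (auto simp: letter_code_def odd_two_times_div_two_succ)
  with \<open>s \<in> S\<close> show "n \<in> letter_code S ` (S \<times> UNIV)" by (metis SigmaI UNIV_I imageI)
qed

lemma letter_code_inv_letter: "letter_code S (inv_letter x) = inv_code (letter_code S x)"
  by (simp add: letter_code_def inv_letter_def inv_code_def)

lemma word_code_simps:
  "word_code S [] = 0"
  "word_code S (x # w) = Suc (prod_encode (letter_code S x, word_code S w))"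
  by (simp_all add: word_code_def)

lemma list_decode_word_code: "list_decode (word_code S w) = map (letter_code S) w"
  by (simp add: word_code_def)

lemma word_code_push_letter:
  assumes "finite S" "x \<in> S \<times> UNIV" "set w \<subseteq> S \<times> UNIV"
  shows "word_code S (push_letter x w) = push_code (letter_code S x) (word_code S w)"
proof (cases w)
  case (Cons y v)
  have "inv_letter x \<in> S \<times> UNIV" using assms(2) by (auto simp: inv_letter_def)
  then have "letter_code S y = inv_code (letter_code S x) \<longleftrightarrow> y = inv_letter x"
    using assms(3) bij_betw_letter_code[OF assms(1)] Cons
    by (auto simp flip: letter_code_inv_letter simp: bij_betw_def dest: inj_onD)
  then show ?thesis using Cons by (simp add: push_code_def word_code_simps)
qed (simp add: push_code_def word_code_simps)

lemma word_code_mult: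
  assumes "finite S" "set u \<subseteq> S \<times> UNIV" "set w \<subseteq> S \<times> UNIV"
  shows "word_code S (foldr push_letter u w) = mult_code (word_code S u) (word_code S w)"
  using assms(2)
proof (induction u)
  case (Cons x u)
  then have "set (foldr push_letter u w) \<subseteq> S \<times> UNIV"
    using assms(3) set_foldr_push[of u w] by auto
  then show ?case
    using Cons word_code_push_letter[OF assms(1)]
    by (simp add: mult_code_def list_decode_word_code)
qed (simp add: mult_code_def list_decode_word_code)

lemma is_word_code_iff:
  assumes S: "finite S"
  shows "is_word_code (card S) c \<longleftrightarrow> c \<in> word_code S ` carrier (free_group S)"
proof
  assume c: "is_word_code (card S) c"
  then have "list_decode c \<in> lists (letter_code S ` (S \<times> UNIV))"
    using bij_betw_letter_code[OF S] by (auto simp: is_word_code_def bij_betw_def)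
  then obtain u where u: "set u \<subseteq> S \<times> UNIV" "list_decode c = map (letter_code S) u"
    by (auto simp: lists_image)
  then have "word_code S u = c" by (metis list_decode_inverse word_code_def)
  \<comment> \<open>The normal form of \<open>u\<close> is reduced, and by the second condition of
    \<open>is_word_code\<close> it has the same code \<open>c\<close>.\<close>
  then have "word_code S (foldr push_letter u []) = c"
    using word_code_mult[OF S u(1), of "[]"] c by (simp add: is_word_code_def word_code_simps)
  moreover have "foldr push_letter u [] \<in> carrier (free_group S)"
    using set_foldr_push[of u "[]"] u(1) by (auto simp: free_group_def reduced_word_foldr)
  ultimately show "c \<in> word_code S ` carrier (free_group S)" by blast
next
  assume "c \<in> word_code S ` carrier (free_group S)"
  then obtain w where w: "set w \<subseteq> S \<times> UNIV" "reduced_word w" "c = word_code S w"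
    by (auto simp: free_group_def)
  have "\<forall>l\<in>set (list_decode c). l < 2 * card S"
    using w bij_betw_letter_code[OF S] by (auto simp: list_decode_word_code bij_betw_def)
  moreover have "mult_code c 0 = c"
    using word_code_mult[OF S w(1), of "[]"] w foldr_push_Nil[OF w(2)] by (simp add: word_code_simps)
  ultimately show "is_word_code (card S) c" by (simp add: is_word_code_def)
qed

section \<open>Patterns as coded graphs\<close>

definition entry_code :: "'s set \<Rightarrow> 'a set \<Rightarrow> ('s \<times> bool) list \<Rightarrow> 'a \<Rightarrow> nat" where
  "entry_code S A w a = prod_encode (word_code S w, to_nat_on A a)"

lemma set_decode_pattern_code:
  assumes "p \<in> patterns S A"
  shows "set_decode (pattern_code S A p) = {entry_code S A w a |w a. p w = Some a}"
proof -
  have "finite (Map.graph p)" using assms by (simp add: patterns_def)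
  then show ?thesis by (auto simp: pattern_code_def Map.graph_def entry_code_def)
qed

lemma entry_code_eq_iff:
  assumes "finite S" "finite A" "w \<in> carrier (free_group S)" "w' \<in> carrier (free_group S)" "a \<in> A" "a' \<in> A"
  shows "entry_code S A w a = entry_code S A w' a' \<longleftrightarrow> w = w' \<and> a = a'"
  using assms inj_onD[OF inj_on_word_code[OF assms(1)]]
    inj_onD[OF inj_on_to_nat_on[OF countable_finite[OF assms(2)]]]
  by (auto simp: entry_code_def prod_encode_eq)

lemma pattern_ranD: "p \<in> patterns S A \<Longrightarrow> p w = Some a \<Longrightarrow> w \<in> carrier (free_group S) \<and> a \<in> A"
  by (auto simp: patterns_def ran_def)

lemma entry_code_mem_pattern_code:
  assumes "finite S" "finite A" "p \<in> patterns S A" "w \<in> carrier (free_group S)" "a \<in> A"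
  shows "entry_code S A w a \<in> set_decode (pattern_code S A p) \<longleftrightarrow> p w = Some a"
  using assms entry_code_eq_iff[OF assms(1,2)]
  by (fastforce simp: set_decode_pattern_code dest: pattern_ranD)

text \<open>If binary digit \<open>e\<close> of \<open>n\<close> is 1, then
  \<open>2 ^ e <= n\<close>, and \<open>2 ^ e\<close> exceeds \<open>e\<close>.\<close>

lemma set_decode_less: "e \<in> set_decode n \<Longrightarrow> e < n"
proof -
  assume "e \<in> set_decode n"
  then have "odd (n div 2 ^ e)" by (simp add: set_decode_def)
  then have "n div 2 ^ e \<noteq> 0" by (rule contrapos_pn) simp
  then have "2 ^ e \<le> n" by (simp add: div_eq_0_iff)
  then show "e < n" using less_exp[of e] by linarith
qed

lemma is_pattern_code_iff:
  assumes S: "finite S" and A: "finite A"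
  shows "is_pattern_code (card S) (card A) n \<longleftrightarrow> n \<in> pattern_code S A ` patterns S A"
proof
  assume n: "is_pattern_code (card S) (card A) n"
  \<comment> \<open>\<open>p\<close> is read off the entries coded in \<open>n\<close>. The second
    conjunct of \<open>is_pattern_code\<close> allows one symbol per word, so \<open>SOME\<close>
    has a single candidate.\<close>
  define p where "p w = (if \<exists>a\<in>A. w \<in> carrier (free_group S) \<and> entry_code S A w a \<in> set_decode n
    then Some (SOME a. a \<in> A \<and> entry_code S A w a \<in> set_decode n) else None)" for w
  have p: "p w = Some a \<longleftrightarrow> w \<in> carrier (free_group S) \<and> a \<in> A \<and> entry_code S A w a \<in> set_decode n" for w a
  proof -
    have uniq: "a = a'" if "w \<in> carrier (free_group S)" "a \<in> A" "entry_code S A w a \<in> set_decode n"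
        "a' \<in> A" "entry_code S A w a' \<in> set_decode n" for a a'
    proof -
      have "fst (prod_decode (entry_code S A w a)) = fst (prod_decode (entry_code S A w a'))"
        by (simp add: entry_code_def)
      then have "entry_code S A w a = entry_code S A w a'"
        using n that(3,5) set_decode_less[OF that(3)] set_decode_less[OF that(5)]
        unfolding is_pattern_code_def by blast
      then show ?thesis using entry_code_eq_iff[OF S A] that by blast
    qed
    show ?thesis
    proof (cases "\<exists>a\<in>A. w \<in> carrier (free_group S) \<and> entry_code S A w a \<in> set_decode n")
      case True
      then have "\<exists>a. a \<in> A \<and> entry_code S A w a \<in> set_decode n" by blast
      from someI_ex[OF this] True uniq show ?thesis unfolding p_def by (auto split: if_splits)
    qed (auto simp: p_def)
  qed
  have sub: "set_decode n \<subseteq> {entry_code S A w a |w a. p w = Some a}"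
  proof
    fix e assume e: "e \<in> set_decode n"
    then have "is_word_code (card S) (fst (prod_decode e))" "snd (prod_decode e) < card A"
      using n set_decode_less[OF e] by (auto simp: is_pattern_code_def)
    moreover have "{..<card A} = to_nat_on A ` A"
      using to_nat_on_finite[OF A] by (simp add: bij_betw_def)
    ultimately obtain w a where "w \<in> carrier (free_group S)" "a \<in> A"
      "fst (prod_decode e) = word_code S w" "snd (prod_decode e) = to_nat_on A a"
      by (auto simp: is_word_code_iff[OF S] set_eq_iff image_iff)
    moreover from this have "e = entry_code S A w a"
      by (metis entry_code_def prod.collapse prod_decode_inverse)
    ultimately show "e \<in> {entry_code S A w a |w a. p w = Some a}" using p e by auto
  qed
  \<comment> \<open>Each word of the support is recovered from one of the finitely many entries,
    which bounds the domain.\<close>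
  have "dom p \<subseteq> (\<lambda>e. inv_into (carrier (free_group S)) (word_code S) (fst (prod_decode e))) ` set_decode n"
  proof
    fix w assume "w \<in> dom p"
    then obtain a where "w \<in> carrier (free_group S)" "entry_code S A w a \<in> set_decode n"
      using p by auto
    then show "w \<in> (\<lambda>e. inv_into (carrier (free_group S)) (word_code S) (fst (prod_decode e))) ` set_decode n"
      by (auto intro!: image_eqI[where x = "entry_code S A w a"] simp: entry_code_def inj_on_word_code[OF S])
  qed
  then have "finite (dom p)" by (rule finite_subset) simp
  then have pat: "p \<in> patterns S A" using p by (auto simp: patterns_def ran_def)
  have "set_decode (pattern_code S A p) = set_decode n"
    unfolding set_decode_pattern_code[OF pat] using sub p by auto
  then have "pattern_code S A p = n" by (metis set_decode_inverse)
  with pat show "n \<in> pattern_code S A ` patterns S A" by blast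
next
  assume "n \<in> pattern_code S A ` patterns S A"
  then obtain p where p: "p \<in> patterns S A" "n = pattern_code S A p" by blast
  have dec: "set_decode n = {entry_code S A w a |w a. p w = Some a}"
    using set_decode_pattern_code p by blast
  have "is_word_code (card S) (fst (prod_decode e)) \<and> snd (prod_decode e) < card A"
    if "e \<in> set_decode n" for e
    using that pattern_ranD[OF p(1)] to_nat_on_less_card[OF A] is_word_code_iff[OF S]
    unfolding dec by (auto simp: entry_code_def)
  moreover have "e = e'" if "e \<in> set_decode n" "e' \<in> set_decode n"
    "fst (prod_decode e) = fst (prod_decode e')" for e e'
    using that pattern_ranD[OF p(1)] inj_onD[OF inj_on_word_code[OF S]]
    unfolding dec by (fastforce simp: entry_code_def)
  ultimately show "is_pattern_code (card S) (card A) n" unfolding is_pattern_code_def by blast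
qed

lemma set_encode_less_power:
  assumes "Q \<subseteq> {..K}" shows "set_encode Q < 2 ^ Suc K"
proof -
  have "set_encode Q \<le> (\<Sum>i\<le>K. 2 ^ i)"
    unfolding set_encode_def by (rule sum_mono2) (use assms in auto)
  also have "\<dots> < 2 ^ Suc K" by (induction K) auto
  finally show ?thesis .
qed

section \<open>Block codes\<close>

text \<open>The compactness argument of the Curtis-Hedlund-Lyndon theorem. The map \<open>x\<close>
  to \<open>f x g\<close> is continuous into a discrete space, hence constant on the trace in
  \<open>X\<close> of some cylinder around each point; finitely many such cylinders cover
  \<open>X\<close>.\<close>

lemma finite_window:
  assumes A: "finite A" and X: "closedin (full_shift_topology G A) X" and g: "g \<in> carrier G"
    and f: "continuous_map (subtopology (full_shift_topology G A) X) (full_shift_topology G B) f"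
  obtains M where "finite M" "M \<subseteq> carrier G"
    "\<And>x x'. x \<in> X \<Longrightarrow> x' \<in> X \<Longrightarrow> (\<And>h. h \<in> M \<Longrightarrow> x h = x' h) \<Longrightarrow> f x g = f x' g"
proof -
  let ?T = "full_shift_topology G A"
  define cyl where "cyl W U \<longleftrightarrow> W = Pi\<^sub>E (carrier G) U \<and> finite {h \<in> carrier G. U h \<noteq> A} \<and>
    (\<forall>h\<in>carrier G. U h \<subseteq> A) \<and> (\<forall>x\<in>W \<inter> X. \<forall>x'\<in>W \<inter> X. f x g = f x' g)" for W U
  have "compact_space ?T"
    using A by (simp add: full_shift_topology_def compact_space_product_topology compact_space_discrete_topology)
  then have comp: "compactin ?T X" using X by (rule closedin_compact_space)
  have fg: "continuous_map (subtopology ?T X) (discrete_topology B) (\<lambda>x. f x g)"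
    using continuous_map_compose[OF f, of "discrete_topology B" "\<lambda>y. y g"]
      continuous_map_product_projection[OF g, of "\<lambda>_. discrete_topology B"]
    by (simp add: full_shift_topology_def comp_def)
  have "\<exists>\<F>. finite \<F> \<and> \<F> \<subseteq> {W. \<exists>U. cyl W U} \<and> X \<subseteq> \<Union>\<F>"
  proof (rule compactinD[OF comp])
    fix W assume "W \<in> {W. \<exists>U. cyl W U}"
    then obtain U where "cyl W U" by blast
    then show "openin ?T W"
      unfolding full_shift_topology_def cyl_def
      by (auto simp: openin_PiE_gen)
  next
    show "X \<subseteq> \<Union>{W. \<exists>U. cyl W U}"
    proof
      fix x assume x: "x \<in> X"
      have XT: "X \<subseteq> topspace ?T" by (rule closedin_subset[OF X])
      then have "f x g \<in> B" using continuous_map_image_subset_topspace[OF fg] x by auto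
      then have "openin (subtopology ?T X) {x' \<in> topspace (subtopology ?T X). f x' g \<in> {f x g}}"
        using fg by (intro openin_continuous_map_preimage[OF fg]) simp
      then obtain V where V: "openin ?T V" "{x' \<in> topspace (subtopology ?T X). f x' g \<in> {f x g}} = V \<inter> X"
        unfolding openin_subtopology by blast
      then have "x \<in> V" using x XT by auto
      then obtain U where "finite {h \<in> carrier G. U h \<noteq> A}" "\<forall>h\<in>carrier G. U h \<subseteq> A"
        "x \<in> Pi\<^sub>E (carrier G) U" "Pi\<^sub>E (carrier G) U \<subseteq> V"
        using V(1) unfolding full_shift_topology_def openin_product_topology_alt by force
      moreover from this have "f x' g = f x g" if "x' \<in> Pi\<^sub>E (carrier G) U \<inter> X" for x'
        using V(2) that by blast
      ultimately have "cyl (Pi\<^sub>E (carrier G) U) U" "x \<in> Pi\<^sub>E (carrier G) U"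
        unfolding cyl_def by auto
      then show "x \<in> \<Union>{W. \<exists>U. cyl W U}" by blast
    qed
  qed
  then obtain \<F> where \<F>: "finite \<F>" "X \<subseteq> \<Union>\<F>" "\<forall>W\<in>\<F>. \<exists>U. cyl W U" by blast
  then obtain U where U: "\<And>W. W \<in> \<F> \<Longrightarrow> cyl W (U W)" by metis
  \<comment> \<open>The coordinates restricted by some cylinder of the finite cover: a point of
    \<open>X\<close> agreeing with \<open>x\<close> on them lies in every covering cylinder that
    contains \<open>x\<close>.\<close>
  define M where "M = (\<Union>W\<in>\<F>. {h \<in> carrier G. U W h \<noteq> A})"
  show ?thesis
  proof
    show "finite M" "M \<subseteq> carrier G" using \<F>(1) U by (auto simp: M_def cyl_def)
    fix x x' assume x: "x \<in> X" "x' \<in> X" "\<And>h. h \<in> M \<Longrightarrow> x h = x' h"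
    from x(1) \<F>(2) obtain W where W: "W \<in> \<F>" "x \<in> W" by blast
    have x'A: "x' \<in> carrier G \<rightarrow>\<^sub>E A"
      using closedin_subset[OF X] x(2) by (auto simp: topspace_full_shift)
    have "x' \<in> Pi\<^sub>E (carrier G) (U W)"
    proof (rule PiE_I)
      fix h assume h: "h \<in> carrier G"
      show "x' h \<in> U W h"
      proof (cases "U W h = A")
        case False
        then have "h \<in> M" using W h by (auto simp: M_def)
        then have "x' h = x h" using x(3) by simp
        moreover have "x h \<in> U W h" using U[OF W(1)] W(2) h by (auto simp: cyl_def)
        ultimately show ?thesis by simp
      qed (use x'A h in auto)
    qed (use x'A in auto)
    then have "x \<in> W \<inter> X" "x' \<in> W \<inter> X"
      using U[OF W(1)] W(2) x(1,2) unfolding cyl_def by blast+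
    then show "f x g = f x' g" using U[OF W(1)] unfolding cyl_def by blast
  qed
qed

text \<open>The domain of a pattern lies in the free group, where \<open>compose\<close> is plain
  composition, so occurrence in the pullback becomes a condition on the points of
  \<open>X\<close>.\<close>

lemma forbidden_patterns_pullback_iff:
  "p \<in> forbidden_patterns S A (pullback G S X) \<longleftrightarrow>
    p \<in> patterns S A \<and> \<not> (\<exists>x\<in>X. \<forall>w a. p w = Some a \<longrightarrow> x (canonical_epi G w) = a)"
proof -
  have "((\<lambda>w. Some (y w)) |` dom p) w = p w \<longleftrightarrow> (\<forall>a. p w = Some a \<longrightarrow> y w = a)" for y w
    by (cases "p w") (auto simp: restrict_map_def)
  then have "(\<lambda>w. Some (y w)) |` dom p = p \<longleftrightarrow> (\<forall>w a. p w = Some a \<longrightarrow> y w = a)" for y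
    by (simp add: fun_eq_iff)
  moreover have "(\<forall>w a. p w = Some a \<longrightarrow> compose (carrier (free_group S)) x (canonical_epi G) w = a) \<longleftrightarrow>
      (\<forall>w a. p w = Some a \<longrightarrow> x (canonical_epi G w) = a)" if "p \<in> patterns S A" for x
    using pattern_ranD[OF that] by (metis compose_eq)
  ultimately show ?thesis
    unfolding forbidden_patterns_def pullback_def bex_simps mem_Collect_eq by (simp cong: conj_cong)
qed

section \<open>Bounding the codes of candidate preimages\<close>

lemma prod_encode_mono2: "i \<le> j \<Longrightarrow> prod_encode (c, i) \<le> prod_encode (c, j)"
proof -
  assume "i \<le> j"
  then have "(c + i) * Suc (c + i) \<le> (c + j) * Suc (c + j)" by (intro mult_le_mono) auto
  then show ?thesis by (simp add: prod_encode_def triangle_def div_le_mono)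
qed

text \<open>By monotonicity in the symbol, each entry of \<open>q\<close> is at most one summand of
  the exponent. All binary digits 1 of \<open>q\<close> thus sit at positions up to the whole
  sum.\<close>

lemma less_preimage_bound:
  assumes D: "finite D" and
    q: "\<And>k. k \<in> set_decode q \<Longrightarrow> \<exists>e\<in>set_decode n. \<exists>m\<in>D. \<exists>i\<le>a.
      k = prod_encode (mult_code (fst (prod_decode e)) m, i)"
  shows "q < preimage_bound D a n"
proof -
  let ?K = "\<Sum>e<n. \<Sum>m\<in>D. prod_encode (mult_code (fst (prod_decode e)) m, a)"
  have "set_decode q \<subseteq> {..?K}"
  proof
    fix k assume "k \<in> set_decode q"
    then obtain e m i where e: "e \<in> set_decode n" and m: "m \<in> D" and i: "i \<le> a"
      and k: "k = prod_encode (mult_code (fst (prod_decode e)) m, i)" using q by blast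
    have "k \<le> prod_encode (mult_code (fst (prod_decode e)) m, a)"
      unfolding k by (rule prod_encode_mono2[OF i])
    also have "\<dots> \<le> (\<Sum>m\<in>D. prod_encode (mult_code (fst (prod_decode e)) m, a))"
      by (rule member_le_sum[OF m _ D]) simp
    also have "\<dots> \<le> ?K"
      by (rule member_le_sum[where f = "\<lambda>e. \<Sum>m\<in>D. prod_encode (mult_code (fst (prod_decode e)) m, a)"])
         (use set_decode_less[OF e] in auto)
    finally show "k \<in> {..?K}" by simp
  qed
  from set_encode_less_power[OF this] show ?thesis by (simp add: preimage_bound_def)
qed

text \<open>The window governs the symbol at the identity alone, and equivariance transports it to
  the other group elements. The words \<open>wd h\<close> let the block code be evaluated inside the
  free group.\<close>

locale block_factor = group G for G :: "('g, 'm) monoid_scheme" (structure) +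
  fixes S :: "'g set" and A :: "'a set" and B :: "'b set" and X :: "('g \<Rightarrow> 'a) set"
    and f :: "('g \<Rightarrow> 'a) \<Rightarrow> 'g \<Rightarrow> 'b" and M :: "'g set" and wd :: "'g \<Rightarrow> ('g \<times> bool) list"
  assumes S: "finite S" "S \<subseteq> carrier G" and A: "finite A" and B: "finite B"
    and X: "X \<subseteq> carrier G \<rightarrow>\<^sub>E A" "\<And>g x. g \<in> carrier G \<Longrightarrow> x \<in> X \<Longrightarrow> shift G g x \<in> X"
    and f: "\<And>x. x \<in> X \<Longrightarrow> f x \<in> carrier G \<rightarrow>\<^sub>E B"
      "\<And>g x. g \<in> carrier G \<Longrightarrow> x \<in> X \<Longrightarrow> f (shift G g x) = shift G g (f x)"
    and M: "finite M" "M \<subseteq> carrier G"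
      "\<And>x x'. x \<in> X \<Longrightarrow> x' \<in> X \<Longrightarrow> (\<And>h. h \<in> M \<Longrightarrow> x h = x' h) \<Longrightarrow> f x \<one> = f x' \<one>"
    and wd: "\<And>h. h \<in> M \<Longrightarrow> wd h \<in> carrier (free_group S)" "\<And>h. h \<in> M \<Longrightarrow> canonical_epi G (wd h) = h"
begin

abbreviation wmult :: "('g \<times> bool) list \<Rightarrow> ('g \<times> bool) list \<Rightarrow> ('g \<times> bool) list" where
  "wmult u w \<equiv> u \<otimes>\<^bsub>free_group S\<^esub> w"

lemma wmult_eq: "wmult u w = foldr push_letter u w"
  by (simp add: free_group_def)

lemma wmult_closed:
  "u \<in> carrier (free_group S) \<Longrightarrow> w \<in> carrier (free_group S) \<Longrightarrow> wmult u w \<in> carrier (free_group S)"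
  by (rule monoid.m_closed[OF group.is_monoid[OF group_free_group]])

lemma canonical_epi_closed: "w \<in> carrier (free_group S) \<Longrightarrow> canonical_epi G w \<in> carrier G"
  using hom_in_carrier[OF canonical_epi_hom[OF S(2)]] .

lemma canonical_epi_wmult:
  "w \<in> carrier (free_group S) \<Longrightarrow> h \<in> M \<Longrightarrow> canonical_epi G (wmult w (wd h)) = canonical_epi G w \<otimes> h"
  using hom_mult[OF canonical_epi_hom[OF S(2)]] wd by simp

text \<open>Shifting by the inverse of \<open>g\<close> moves coordinate \<open>g\<close> to the
  identity.\<close>

lemma factor_apply:
  assumes "x \<in> X" "g \<in> carrier G" shows "f x g = f (shift G (inv g) x) \<one>"
  using assms f(2)[of "inv g" x] by (simp add: shift_def)

lemma shift_inv_apply: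
  "g \<in> carrier G \<Longrightarrow> h \<in> M \<Longrightarrow> shift G (inv g) x h = x (g \<otimes> h)"
  using M(2) by (auto simp: shift_def)

text \<open>The local rule enters through its graph: it is partial, defined on those window contents
  that occur in points of \<open>X\<close>. So \<open>q\<close> must show such a content at every
  word of the support of \<open>p\<close>.\<close>

definition matches :: "(('g \<times> bool) list \<rightharpoonup> 'b) \<Rightarrow> (('g \<times> bool) list \<rightharpoonup> 'a) \<Rightarrow> bool" where
  "matches p q \<longleftrightarrow> (\<forall>w b. p w = Some b \<longrightarrow>
    (\<exists>x\<in>X. b = f x \<one> \<and> (\<forall>h\<in>M. q (wmult w (wd h)) = Some (x h))))"

text \<open>If \<open>x\<close> realised \<open>q\<close>, then at each \<open>w\<close> in the
  support of \<open>p\<close> the translate of \<open>x\<close> would agree on the window with the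
  point witnessing the match. So \<open>f x\<close> would realise \<open>p\<close>.\<close>

lemma matches_forbidden:
  assumes p: "p \<in> forbidden_patterns S B (pullback G S (f ` X))"
    and q: "q \<in> patterns S A" "matches p q"
  shows "q \<in> forbidden_patterns S A (pullback G S X)"
proof (rule ccontr)
  assume "q \<notin> forbidden_patterns S A (pullback G S X)"
  then obtain x where x: "x \<in> X" "\<And>w a. q w = Some a \<Longrightarrow> x (canonical_epi G w) = a"
    using q(1) by (auto simp: forbidden_patterns_pullback_iff)
  have "f x (canonical_epi G w) = b" if w: "p w = Some b" for w b
  proof -
    obtain x' where x': "x' \<in> X" "b = f x' \<one>" "\<forall>h\<in>M. q (wmult w (wd h)) = Some (x' h)"
      using q(2) w by (auto simp: matches_def)
    have wF: "w \<in> carrier (free_group S)"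
      using p w by (auto simp: forbidden_patterns_def dest: pattern_ranD)
    note wG = canonical_epi_closed[OF wF]
    have "f (shift G (inv canonical_epi G w) x) \<one> = f x' \<one>"
    proof (rule M(3))
      show "shift G (inv canonical_epi G w) x \<in> X" using X(2) wG x(1) by simp
      fix h assume h: "h \<in> M"
      then show "shift G (inv canonical_epi G w) x h = x' h"
        using x(2) x'(3) by (simp add: shift_inv_apply[OF wG] flip: canonical_epi_wmult[OF wF h])
    qed (rule x')
    then show ?thesis using factor_apply[OF x(1) wG] x'(2) by simp
  qed
  with p x(1) show False by (auto simp: forbidden_patterns_pullback_iff)
qed

text \<open>If \<open>f x\<close> realises \<open>p\<close>, restrict \<open>x\<close> to the
  translates of the window along the support of \<open>p\<close>. The result is realised by
  \<open>x\<close>, and the translates of \<open>x\<close> witness the match. Its confined support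
  later bounds its code.\<close>

lemma matching_extension:
  assumes p: "p \<in> patterns S B" "p \<notin> forbidden_patterns S B (pullback G S (f ` X))"
  obtains q where "q \<in> patterns S A" "q \<notin> forbidden_patterns S A (pullback G S X)" "matches p q"
    "\<And>v. v \<in> dom q \<Longrightarrow> \<exists>w\<in>dom p. \<exists>h\<in>M. v = wmult w (wd h)"
proof -
  from p obtain x where x: "x \<in> X" "\<And>w b. p w = Some b \<Longrightarrow> f x (canonical_epi G w) = b"
    by (auto simp: forbidden_patterns_pullback_iff)
  define W where "W = (\<lambda>(w, h). wmult w (wd h)) ` (dom p \<times> M)"
  define q where "q = (\<lambda>v. Some (x (canonical_epi G v))) |` W"
  have p': "dom p \<subseteq> carrier (free_group S)" "finite (dom p)" using p(1) by (auto simp: patterns_def)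
  have W: "finite W" "W \<subseteq> carrier (free_group S)"
    using p' M(1) wmult_closed wd by (auto simp: W_def)
  have q_Some: "q v = Some a \<longleftrightarrow> v \<in> W \<and> a = x (canonical_epi G v)" for v a
    by (auto simp: q_def restrict_map_def)
  have "dom q = W" by (auto simp: q_Some dom_def)
  show ?thesis
  proof
    show pat: "q \<in> patterns S A"
      using W X(1) x(1) canonical_epi_closed by (fastforce simp: patterns_def \<open>dom q = W\<close> ran_def q_Some)
    show "q \<notin> forbidden_patterns S A (pullback G S X)"
      using x(1) by (auto simp: forbidden_patterns_pullback_iff q_Some)
    show "matches p q"
      unfolding matches_def
    proof (intro allI impI)
      fix w b assume w: "p w = Some b"
      then have wF: "w \<in> carrier (free_group S)" using p' by auto
      note wG = canonical_epi_closed[OF wF]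
      let ?x = "shift G (inv canonical_epi G w) x"
      have "?x \<in> X" using X(2) wG x(1) by simp
      moreover have "b = f ?x \<one>" using factor_apply[OF x(1) wG] x(2)[OF w] by simp
      moreover have "q (wmult w (wd h)) = Some (?x h)" if "h \<in> M" for h
        using w that by (auto simp: q_Some W_def shift_inv_apply[OF wG] canonical_epi_wmult[OF wF])
      ultimately show "\<exists>x\<in>X. b = f x \<one> \<and> (\<forall>h\<in>M. q (wmult w (wd h)) = Some (x h))" by blast
    qed
    show "\<exists>w\<in>dom p. \<exists>h\<in>M. v = wmult w (wd h)" if "v \<in> dom q" for v
      using that by (auto simp: \<open>dom q = W\<close> W_def)
  qed
qed

text \<open>The graph of the local rule in codes, listed through the points of \<open>X\<close>.
  Finiteness of \<open>M\<close>, \<open>A\<close> and \<open>B\<close> leaves finitely many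
  distinct entries, so the table can be built into an algorithm as a constant; its existence
  suffices.\<close>

definition rule_table :: "((nat \<times> nat) set \<times> nat) set" where
  "rule_table = (\<lambda>x. ((\<lambda>h. (word_code S (wd h), to_nat_on A (x h))) ` M, to_nat_on B (f x \<one>))) ` X"

lemma finite_rule_table: "finite rule_table" "t \<in> rule_table \<Longrightarrow> finite (fst t)"
proof -
  have "rule_table \<subseteq> Pow ((\<lambda>h. word_code S (wd h)) ` M \<times> {..<card A}) \<times> {..<card B}"
  proof
    fix t assume "t \<in> rule_table"
    then obtain x where x: "x \<in> X"
      "t = ((\<lambda>h. (word_code S (wd h), to_nat_on A (x h))) ` M, to_nat_on B (f x \<one>))"
      by (auto simp: rule_table_def)
    have "x h \<in> A" if "h \<in> M" for h using X(1) M(2) x(1) that by auto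
    moreover have "f x \<one> \<in> B" using f(1)[OF x(1)] by auto
    ultimately show "t \<in> Pow ((\<lambda>h. word_code S (wd h)) ` M \<times> {..<card A}) \<times> {..<card B}"
      using to_nat_on_less_card[OF A] to_nat_on_less_card[OF B] by (auto simp: x(2))
  qed
  then show "finite rule_table" by (rule finite_subset) (use M(1) in auto)
  show "t \<in> rule_table \<Longrightarrow> finite (fst t)" using M(1) by (auto simp: rule_table_def)
qed

lemma word_code_wmult:
  "u \<in> carrier (free_group S) \<Longrightarrow> w \<in> carrier (free_group S) \<Longrightarrow>
    mult_code (word_code S u) (word_code S w) = word_code S (wmult u w)"
  by (simp add: wmult_eq) (simp add: free_group_def word_code_mult[OF S(1)])

text \<open>Injectivity of the codings turns digit tests on the numbers into values of
  \<open>p\<close> and \<open>q\<close>, first at a single entry of \<open>p\<close>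
  (\<open>local\<close>), then over all entries.\<close>

lemma factor_consistent_iff_matches:
  assumes p: "p \<in> patterns S B" and q: "q \<in> patterns S A"
  shows "factor_consistent rule_table (pattern_code S B p) (pattern_code S A q) \<longleftrightarrow> matches p q"
proof -
  have local: "(\<exists>t\<in>rule_table. to_nat_on B b = snd t \<and>
      (\<forall>m\<in>fst t. prod_encode (mult_code (word_code S w) (fst m), snd m) \<in> set_decode (pattern_code S A q))) \<longleftrightarrow>
    (\<exists>x\<in>X. b = f x \<one> \<and> (\<forall>h\<in>M. q (wmult w (wd h)) = Some (x h)))" if w: "p w = Some b" for w b
  proof -
    have wF: "w \<in> carrier (free_group S)" and b: "b \<in> B" using pattern_ranD[OF p w] by auto
    have "prod_encode (mult_code (word_code S w) (word_code S (wd h)), to_nat_on A (x h)) \<in> set_decode (pattern_code S A q)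
        \<longleftrightarrow> q (wmult w (wd h)) = Some (x h)" if "x \<in> X" "h \<in> M" for x h
    proof -
      have "x h \<in> A" using X(1) M(2) that by auto
      then show ?thesis
        using entry_code_mem_pattern_code[OF S(1) A q wmult_closed[OF wF wd(1)[OF that(2)]]]
        by (simp add: word_code_wmult wF wd that entry_code_def)
    qed
    moreover have "to_nat_on B b = to_nat_on B (f x \<one>) \<longleftrightarrow> b = f x \<one>" if "x \<in> X" for x
      using f(1)[OF that] b inj_onD[OF inj_on_to_nat_on[OF countable_finite[OF B]]] by auto
    ultimately show ?thesis by (simp add: rule_table_def)
  qed
  define Q where "Q e \<longleftrightarrow> (\<exists>t\<in>rule_table. snd (prod_decode e) = snd t \<and>
      (\<forall>m\<in>fst t. prod_encode (mult_code (fst (prod_decode e)) (fst m), snd m) \<in> set_decode (pattern_code S A q)))" for e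
  have "factor_consistent rule_table (pattern_code S B p) (pattern_code S A q) \<longleftrightarrow>
      (\<forall>e\<in>set_decode (pattern_code S B p). Q e)"
    unfolding factor_consistent_def Q_def using set_decode_less by blast
  also have "\<dots> \<longleftrightarrow> (\<forall>w b. p w = Some b \<longrightarrow> Q (entry_code S B w b))"
    unfolding set_decode_pattern_code[OF p] by blast
  also have "\<dots> \<longleftrightarrow> matches p q"
    using local by (simp add: Q_def entry_code_def matches_def cong: imp_cong)
  finally show ?thesis .
qed

text \<open>\<open>?V\<close> tests only matches with small codes. If \<open>p\<close> is forbidden,
  all its matches are forbidden, whatever their codes; if not, the window pattern of a realising
  point is a match that is not forbidden and lies below the bound.\<close>

lemma effectively_closed_image:
  assumes "effectively_closed S A (pullback G S X)"
  shows "effectively_closed S B (pullback G S (f ` X))"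
proof -
  let ?U = "pattern_code S A ` forbidden_patterns S A (pullback G S X)"
  let ?D = "(\<lambda>h. word_code S (wd h)) ` M"
  let ?V = "{n. is_pattern_code (card S) (card B) n \<and> (\<forall>q<preimage_bound ?D (card A) n.
    is_pattern_code (card S) (card A) q \<and> factor_consistent rule_table n q \<longrightarrow> q \<in> ?U)}"
  have mem_U: "pattern_code S A q \<in> ?U \<longleftrightarrow> q \<in> forbidden_patterns S A (pullback G S X)"
    if "q \<in> patterns S A" for q
    using that inj_onD[OF inj_on_pattern_code[OF S(1) A]] by (auto simp: forbidden_patterns_def)
  have "pattern_code S B ` forbidden_patterns S B (pullback G S (f ` X)) = ?V"
  proof (intro equalityI subsetI)
    fix n assume "n \<in> pattern_code S B ` forbidden_patterns S B (pullback G S (f ` X))"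
    then obtain p where p: "p \<in> forbidden_patterns S B (pullback G S (f ` X))" "n = pattern_code S B p" by blast
    then have pat: "p \<in> patterns S B" by (simp add: forbidden_patterns_def)
    then show "n \<in> ?V"
      using p matches_forbidden[OF p(1)] factor_consistent_iff_matches[OF pat]
      by (auto simp: is_pattern_code_iff[OF S(1)] A B)
  next
    fix n assume n: "n \<in> ?V"
    then obtain p where p: "p \<in> patterns S B" "n = pattern_code S B p"
      using is_pattern_code_iff[OF S(1) B] by blast
    have "p \<in> forbidden_patterns S B (pullback G S (f ` X))"
    proof (rule ccontr)
      assume "p \<notin> forbidden_patterns S B (pullback G S (f ` X))"
      then obtain q where q: "q \<in> patterns S A" "q \<notin> forbidden_patterns S A (pullback G S X)"
        "matches p q" "\<And>v. v \<in> dom q \<Longrightarrow> \<exists>w\<in>dom p. \<exists>h\<in>M. v = wmult w (wd h)"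
        using matching_extension[OF p(1)] by blast
      have "pattern_code S A q < preimage_bound ?D (card A) n"
      proof (rule less_preimage_bound)
        fix k assume "k \<in> set_decode (pattern_code S A q)"
        then obtain v a where v: "k = entry_code S A v a" "q v = Some a"
          by (auto simp: set_decode_pattern_code[OF q(1)])
        then obtain w b h where w: "p w = Some b" "h \<in> M" "v = wmult w (wd h)" using q(4)[of v] by blast
        have "entry_code S B w b \<in> set_decode n"
          using w(1) by (auto simp: p(2) set_decode_pattern_code[OF p(1)])
        moreover have "k = prod_encode (mult_code (fst (prod_decode (entry_code S B w b))) (word_code S (wd h)), to_nat_on A a)"
          using pattern_ranD[OF p(1) w(1)] w v by (simp add: entry_code_def word_code_wmult wd)
        \<comment> \<open>Symbol codes are even strictly below \<open>card A\<close>, the value that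
          the bound puts in their place.\<close>
        moreover have "to_nat_on A a \<le> card A"
          using to_nat_on_less_card[OF A] pattern_ranD[OF q(1) v(2)] by (simp add: less_imp_le)
        ultimately show "\<exists>e\<in>set_decode n. \<exists>m\<in>?D. \<exists>i\<le>card A. k = prod_encode (mult_code (fst (prod_decode e)) m, i)"
          using w(2) by blast
      qed (use M(1) in simp)
      moreover have "is_pattern_code (card S) (card A) (pattern_code S A q)"
        using is_pattern_code_iff[OF S(1) A] q(1) by blast
      moreover have "factor_consistent rule_table n (pattern_code S A q)"
        using factor_consistent_iff_matches[OF p(1) q(1)] q(3) p(2) by simp
      ultimately have "pattern_code S A q \<in> ?U" using n by blast
      then show False using mem_U[OF q(1)] q(2) by blast
    qed
    with p(2) show "n \<in> pattern_code S B ` forbidden_patterns S B (pullback G S (f ` X))" by blast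
  qed
  moreover have "recursively_enumerable ?V"
    by (rule recursively_enumerable_factor)
       (use assms finite_rule_table M(1) in \<open>auto simp: effectively_closed_def\<close>)
  ultimately show ?thesis by (simp add: effectively_closed_def)
qed

end

section \<open>From a continuous equivariant map to a block code\<close>

theorem corollary8p11:
  fixes G :: "('g, 'm) monoid_scheme"
    and A :: "'a set" and B :: "'b set"
    and X :: "('g \<Rightarrow> 'a) set" and Y :: "('g \<Rightarrow> 'b) set"
  assumes "group G" and "finitely_generated G"
    and "finite A" and "finite B"
    and "effective_subshift G A X"
    and "subshift G B Y"
    and "topological_factor G A X B Y"
  shows "effective_subshift G B Y"
proof -
  interpret group G by fact
  from \<open>topological_factor G A X B Y\<close> obtain f where
    f: "continuous_map (subtopology (full_shift_topology G A) X) (subtopology (full_shift_topology G B) Y) f"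
      "f ` X = Y" "\<And>g x. g \<in> carrier G \<Longrightarrow> x \<in> X \<Longrightarrow> f (shift G g x) = shift G g (f x)"
    by (auto simp: topological_factor_def)
  from \<open>effective_subshift G A X\<close> obtain S where X: "subshift G A X" and
    S: "finite S" "S \<subseteq> carrier G" "generate G S = carrier G"
    and eff: "effectively_closed S A (pullback G S X)"
    by (auto simp: effective_subshift_def finite_generating_set_def)
  have closed: "closedin (full_shift_topology G A) X" "closedin (full_shift_topology G B) Y"
    using X \<open>subshift G B Y\<close> by (auto simp: subshift_def)
  have "continuous_map (subtopology (full_shift_topology G A) X) (full_shift_topology G B) f"
    using f(1) by (simp add: continuous_map_in_subtopology)
  then obtain M where M: "finite M" "M \<subseteq> carrier G"
    "\<And>x x'. x \<in> X \<Longrightarrow> x' \<in> X \<Longrightarrow> (\<And>h. h \<in> M \<Longrightarrow> x h = x' h) \<Longrightarrow> f x \<one>\<^bsub>G\<^esub> = f x' \<one>\<^bsub>G\<^esub>"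
    by (rule finite_window[OF \<open>finite A\<close> closed(1) one_closed]) blast
  \<comment> \<open>Since \<open>S\<close> generates \<open>G\<close>, the canonical epimorphism is
    onto, and every window element is represented by a word.\<close>
  have "\<forall>h\<in>M. \<exists>w. w \<in> carrier (free_group S) \<and> canonical_epi G w = h"
  proof
    fix h assume "h \<in> M"
    then have "h \<in> canonical_epi G ` carrier (free_group S)"
      using canonical_epi_image[OF S(2)] S(3) M(2) by auto
    then show "\<exists>w. w \<in> carrier (free_group S) \<and> canonical_epi G w = h" by blast
  qed
  then obtain wd where wd: "\<And>h. h \<in> M \<Longrightarrow> wd h \<in> carrier (free_group S)"
    "\<And>h. h \<in> M \<Longrightarrow> canonical_epi G (wd h) = h" by metis
  interpret block_factor G S A B X f M wd
  proof unfold_locales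
    show "X \<subseteq> carrier G \<rightarrow>\<^sub>E A"
      using closedin_subset[OF closed(1)] by (simp add: topspace_full_shift)
    show "f x \<in> carrier G \<rightarrow>\<^sub>E B" if "x \<in> X" for x
      using closedin_subset[OF closed(2)] f(2) that by (auto simp: topspace_full_shift)
    show "shift G g x \<in> X" if "g \<in> carrier G" "x \<in> X" for g x
      using X that by (simp add: subshift_def)
  qed (fact S f M wd \<open>finite A\<close> \<open>finite B\<close>)+
  \<comment> \<open>The generating set that witnesses effectiveness of \<open>X\<close> also serves
    for \<open>Y\<close>.\<close>
  show ?thesis
    using effectively_closed_image[OF eff] \<open>f ` X = Y\<close> \<open>generate G S = carrier G\<close>
      \<open>finite S\<close> \<open>S \<subseteq> carrier G\<close> \<open>subshift G B Y\<close>
    unfolding effective_subshift_def finite_generating_set_def by blast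
qed

end
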